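(* Let $p\ge2$, $\gamma>0$, and let $f:\mathbb{R}\to\mathbb{R}$ be locally Lipschitz with $f(0)=0$. If $p>2$, assume further that there exist $\epsilon_0>0$ and $a_0>0$ such that $$\sup_{0<x\ne y<\epsilon_0}\frac{f(x)-f(y)}{x-y}\le -a_0<0.$$ Let $(u,w)$ be a classical ($C^2$) solution of $$-\Delta u-\gamma w|u|^{p-2}u=f(u),\qquad -\Delta w=|u|^p\quad\text{in }\mathbb{R}^2,$$ with $0<u\in L^\infty(\mathbb{R}^2)$ and $w(x)\to-\infty$ as $|x|\to\infty$. Then $u$ and $w$ are radially symmetric and strictly decreasing (in the radial variable) with respect to some point $x_0\in\mathbb{R}^2$. *)

theory Defs
  imports "HOL-Analysis.Analysis"
begin

definition pd :: "2 \<Rightarrow> (real^2 \<Rightarrow> real) \<Rightarrow> real^2 \<Rightarrow> real" where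
  "pd i f x = deriv (\<lambda>t. f (x + t *\<^sub>R axis i 1)) 0"

definition has_pd :: "2 \<Rightarrow> (real^2 \<Rightarrow> real) \<Rightarrow> bool" where
  "has_pd i f \<longleftrightarrow> (\<forall>x. (\<lambda>t. f (x + t *\<^sub>R axis i 1)) differentiable (at 0))"

definition C2 :: "(real^2 \<Rightarrow> real) \<Rightarrow> bool" where
  "C2 f \<longleftrightarrow> continuous_on UNIV f \<and>
     (\<forall>i. has_pd i f \<and> continuous_on UNIV (pd i f) \<and>
        (\<forall>j. has_pd j (pd i f) \<and> continuous_on UNIV (pd j (pd i f))))"

definition laplacian :: "(real^2 \<Rightarrow> real) \<Rightarrow> real^2 \<Rightarrow> real" where
  "laplacian f x = (\<Sum>i\<in>UNIV. pd i (pd i f) x)"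

definition locally_lipschitz :: "(real \<Rightarrow> real) \<Rightarrow> bool" where
  "locally_lipschitz f \<longleftrightarrow> (\<forall>x. \<exists>e>0. \<exists>L. L-lipschitz_on (cball x e) f)"

end

(* Where w is very negative the equation for u is coercive, so u decays exponentially and -Delta w is
   integrable; mean values then show that w decreases at most logarithmically. This is enough for a
   Phragmen-Lindelof principle on half-planes: if u_l - u >= -s beyond the line x = l, then w_l - w is
   at least a fixed multiple of -s. Coercivity at a negative minimum of u_l - u contradicts this unless u is not
   small there, so such minima stay in a ball that does not depend on l. Hence the plane can be
   moved in from infinity, and when it stops, the minima converge to a point where the strong
   maximum principle or Hopf's lemma forces u_l = u. *)

theory Submission
  imports Defs "HOL-Real_Asymp.Real_Asymp"
begin

section \<open>Pointwise Laplacians and minimum principles\<close>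

text \<open>Two functions move at once: \<open>U l\<close>, the reflected minus the original
  \<open>u\<close>, and \<open>W l\<close>, the same for \<open>w\<close>. The equation for
  \<open>W l\<close> has no zero-order term that could absorb a negative minimum, so
  \<open>W l\<close> is controlled only by comparison with the explicit function
  \<open>K * s * (exp (\<beta> * l) - exp (\<beta> * Re z))\<close>, whose constants are independent
  of \<open>l\<close>. The smallness needed at a negative minimum of \<open>U l\<close> comes from
  the coefficient \<open>u (mirror l z) powr (p - 1)\<close> of \<open>W l\<close>, which is below
  \<open>u z powr (p - 1)\<close> there. The minima may converge to a point of the line of
  reflection, where \<open>U l\<close> vanishes anyway. Hence the vanishing of their normal
  derivative is carried along the sequence, and this is what Hopf's lemma refutes. All analysis is
  done in the complex plane with vertical lines of reflection, where the half-plane barrier is the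
  real part of a holomorphic square root. Other directions follow by rotation, and two orthogonal
  axes of symmetry determine the centre.\<close>

definition has_d2 :: "(complex \<Rightarrow> real) \<Rightarrow> complex \<Rightarrow> complex \<Rightarrow> real \<Rightarrow> bool" where
  "has_d2 F z d l \<longleftrightarrow> (\<exists>D. (\<forall>\<^sub>F t in nhds 0. ((\<lambda>t. F (z + of_real t * d)) has_real_derivative D t) (at t)) \<and>
     (D has_real_derivative l) (at 0))"

text \<open>A relation at a single point instead of an operator: sums, multiples and reflections
  then carry no differentiability side conditions, and barriers may be smooth only near the point in
  question.\<close>

definition has_lap :: "(complex \<Rightarrow> real) \<Rightarrow> complex \<Rightarrow> real \<Rightarrow> bool" where
  "has_lap F z l \<longleftrightarrow> (\<exists>a b. has_d2 F z 1 a \<and> has_d2 F z \<i> b \<and> l = a + b)"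

lemma has_d2_add:
  assumes "has_d2 F z d a" "has_d2 G z d b"
  shows "has_d2 (\<lambda>z. F z + G z) z d (a + b)"
proof -
  from assms obtain D E where
    D: "\<forall>\<^sub>F t in nhds 0. ((\<lambda>t. F (z + of_real t * d)) has_real_derivative D t) (at t)" "(D has_real_derivative a) (at 0)"
    and E: "\<forall>\<^sub>F t in nhds 0. ((\<lambda>t. G (z + of_real t * d)) has_real_derivative E t) (at t)" "(E has_real_derivative b) (at 0)"
    unfolding has_d2_def by blast
  have "\<forall>\<^sub>F t in nhds 0. ((\<lambda>t. F (z + of_real t * d) + G (z + of_real t * d)) has_real_derivative D t + E t) (at t)"
    using D(1) E(1) by eventually_elim (rule DERIV_add)
  moreover have "((\<lambda>t. D t + E t) has_real_derivative a + b) (at 0)"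
    using D(2) E(2) by (rule DERIV_add)
  ultimately show ?thesis unfolding has_d2_def by (intro exI[of _ "\<lambda>t. D t + E t"] conjI)
qed

lemma has_d2_cmult:
  assumes "has_d2 F z d a"
  shows "has_d2 (\<lambda>z. c * F z) z d (c * a)"
proof -
  from assms obtain D where
    D: "\<forall>\<^sub>F t in nhds 0. ((\<lambda>t. F (z + of_real t * d)) has_real_derivative D t) (at t)" "(D has_real_derivative a) (at 0)"
    unfolding has_d2_def by blast
  have "\<forall>\<^sub>F t in nhds 0. ((\<lambda>t. c * F (z + of_real t * d)) has_real_derivative c * D t) (at t)"
    using D(1) by eventually_elim (rule DERIV_cmult)
  moreover have "((\<lambda>t. c * D t) has_real_derivative c * a) (at 0)"
    using D(2) by (rule DERIV_cmult)
  ultimately show ?thesis unfolding has_d2_def by (intro exI[of _ "\<lambda>t. c * D t"] conjI)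
qed

lemma filterlim_line: "filterlim (\<lambda>t::real. z + of_real t * d) (nhds z) (nhds (0::real))" for z d :: complex
  by (rule tendsto_eq_intros filterlim_ident | simp)+

lemma has_d2_minus_dir:
  assumes "has_d2 F z d a"
  shows "has_d2 F z (- d) a"
proof -
  from assms obtain D where
    D: "\<forall>\<^sub>F t in nhds 0. ((\<lambda>t. F (z + of_real t * d)) has_real_derivative D t) (at t)" "(D has_real_derivative a) (at 0)"
    unfolding has_d2_def by blast
  have m: "filterlim (\<lambda>t::real. - t) (nhds 0) (nhds 0)"
    by (rule tendsto_eq_intros filterlim_ident | simp)+
  have "\<forall>\<^sub>F t in nhds 0. ((\<lambda>t. F (z + of_real t * d)) has_real_derivative D (- t)) (at (- t))"
    using eventually_compose_filterlim[OF D(1) m] .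
  then have "\<forall>\<^sub>F t in nhds 0. ((\<lambda>t. F (z + of_real t * (- d))) has_real_derivative - D (- t)) (at t)"
  proof eventually_elim
    case (elim t)
    have "((\<lambda>t. F (z + of_real (- t) * d)) has_real_derivative D (- t) * (- 1)) (at t)"
      by (rule DERIV_chain'[where f = "\<lambda>t. - t" and g = "\<lambda>t. F (z + of_real t * d)"])
         (auto intro!: derivative_eq_intros elim)
    then show ?case by simp
  qed
  moreover have "((\<lambda>t. - D (- t)) has_real_derivative a) (at 0)"
  proof -
    have "((\<lambda>t. D (- t)) has_real_derivative a * (- 1)) (at 0)"
      by (rule DERIV_chain'[where f = "\<lambda>t. - t" and g = D]) (auto intro!: derivative_eq_intros D(2))
    from DERIV_minus[OF this] show ?thesis by simp
  qed
  ultimately show ?thesis unfolding has_d2_def by (intro exI[of _ "\<lambda>t. - D (- t)"] conjI)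
qed

lemma has_lap_add: "has_lap F z a \<Longrightarrow> has_lap G z b \<Longrightarrow> has_lap (\<lambda>z. F z + G z) z (a + b)"
  unfolding has_lap_def
proof safe
  fix a b c d
  assume "has_d2 F z 1 a" "has_d2 F z \<i> b" "has_d2 G z 1 c" "has_d2 G z \<i> d"
  then show "\<exists>x y. has_d2 (\<lambda>z. F z + G z) z 1 x \<and> has_d2 (\<lambda>z. F z + G z) z \<i> y \<and> a + b + (c + d) = x + y"
    by (intro exI[of _ "a + c"] exI[of _ "b + d"] conjI has_d2_add) auto
qed

lemma has_lap_cmult: "has_lap F z a \<Longrightarrow> has_lap (\<lambda>z. c * F z) z (c * a)"
  unfolding has_lap_def by (metis has_d2_cmult distrib_left)

lemma has_lap_minus: "has_lap F z a \<Longrightarrow> has_lap (\<lambda>z. - F z) z (- a)"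
  using has_lap_cmult[of F z a "-1"] by simp

lemma has_lap_diff: "has_lap F z a \<Longrightarrow> has_lap G z b \<Longrightarrow> has_lap (\<lambda>z. F z - G z) z (a - b)"
  using has_lap_add[OF _ has_lap_minus, of F z a G b] by simp

lemma has_d2_const: "has_d2 (\<lambda>z. c) z d 0"
  unfolding has_d2_def by (intro exI[of _ "\<lambda>t. 0"]) auto

lemma has_lap_const: "has_lap (\<lambda>z. c) z 0"
  unfolding has_lap_def using has_d2_const by force

section \<open>Reflections in vertical lines\<close>

definition mirror :: "real \<Rightarrow> complex \<Rightarrow> complex" where
  "mirror l z = Complex (2 * l - Re z) (Im z)"

lemma Re_mirror [simp]: "Re (mirror l z) = 2 * l - Re z" and Im_mirror [simp]: "Im (mirror l z) = Im z"
  by (simp_all add: mirror_def)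

lemma mirror_mirror [simp]: "mirror l (mirror l z) = z"
  by (simp add: complex_eq_iff)

lemma continuous_mirror2: "continuous_on UNIV (\<lambda>x. mirror (fst x) (snd x))"
  unfolding mirror_def Complex_eq by (intro continuous_intros)

lemma continuous_mirror: "continuous_on S (mirror l)"
  unfolding mirror_def Complex_eq by (intro continuous_intros)

text \<open>The reflection reverses the real direction and keeps the imaginary one, and a second
  derivative does not see the sign of its direction.\<close>

lemma has_lap_mirror:
  assumes "has_lap F (mirror l z) a"
  shows "has_lap (\<lambda>z. F (mirror l z)) z a"
proof -
  from assms obtain x y where *: "has_d2 F (mirror l z) 1 x" "has_d2 F (mirror l z) \<i> y" "a = x + y"
    unfolding has_lap_def by blast
  have r1: "mirror l (z + of_real t * 1) = mirror l z + of_real t * (- 1)"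
    and r2: "mirror l (z + of_real t * \<i>) = mirror l z + of_real t * \<i>" for t
    by (auto simp: complex_eq_iff)
  have "has_d2 (\<lambda>z. F (mirror l z)) z 1 x"
    using has_d2_minus_dir[OF *(1)] unfolding has_d2_def r1 .
  moreover have "has_d2 (\<lambda>z. F (mirror l z)) z \<i> y"
    using *(2) unfolding has_d2_def r2 .
  ultimately show ?thesis unfolding has_lap_def using *(3) by blast
qed

lemma has_d2_local_min:
  assumes "has_d2 F z d l" and mn: "\<forall>\<^sub>F x in nhds z. F z \<le> F x"
  shows "0 \<le> l"
proof (rule ccontr)
  assume "\<not> 0 \<le> l"
  then have neg: "l < 0" by simp
  from assms(1) obtain D where
    D: "\<forall>\<^sub>F t in nhds 0. ((\<lambda>t. F (z + of_real t * d)) has_real_derivative D t) (at t)" "(D has_real_derivative l) (at 0)"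
    unfolding has_d2_def by blast
  note c = filterlim_line[of z d]
  have mn': "\<forall>\<^sub>F t in nhds 0. F z \<le> F (z + of_real t * d)"
    using eventually_compose_filterlim[OF mn c] .
  from eventually_conj[OF D(1) mn'] obtain e where e: "e > 0"
    and eD: "\<And>t. \<bar>t\<bar> < e \<Longrightarrow> ((\<lambda>t. F (z + of_real t * d)) has_real_derivative D t) (at t)"
    and eM: "\<And>t. \<bar>t\<bar> < e \<Longrightarrow> F z \<le> F (z + of_real t * d)"
    unfolding eventually_nhds_metric by (auto simp: dist_real_def)
  have D0: "D 0 = 0"
    by (rule DERIV_local_min[OF eD e]) (use e eM in auto)
  from DERIV_neg_dec_right[OF D(2) neg] obtain h where h: "h > 0" "\<And>t. 0 < t \<Longrightarrow> t < h \<Longrightarrow> D t < 0"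
    using D0 by auto
  define s where "s = min h e / 2"
  have s: "0 < s" "s < h" "s < e" using h e by (auto simp: s_def)
  have "\<exists>y. 0 < y \<and> y < s \<and> F (z + of_real s * d) - F (z + of_real 0 * d) = (s - 0) * D y"
    by (rule MVT2) (use s eD in auto)
  then obtain y where y: "0 < y" "y < s" "F (z + of_real s * d) - F z = s * D y" by auto
  have "s * D y < 0" using h(2)[of y] y s by (simp add: mult_pos_neg)
  with y eM[of s] s show False by simp
qed

lemma has_lap_local_min:
  assumes "has_lap F z l" "\<forall>\<^sub>F x in nhds z. F z \<le> F x"
  shows "0 \<le> l"
  using assms has_d2_local_min unfolding has_lap_def by fastforce

section \<open>Laplacians of the explicit barriers\<close>

lemma has_d2_exp_linear:
  "has_d2 (\<lambda>z. exp (a * Re z + b * Im z)) z d ((a * Re d + b * Im d)^2 * exp (a * Re z + b * Im z))"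
  unfolding has_d2_def
  by (rule exI[of _ "\<lambda>t. (a * Re d + b * Im d) * exp (a * (Re z + t * Re d) + b * (Im z + t * Im d))"])
     (auto intro!: derivative_eq_intros always_eventually simp: power2_eq_square algebra_simps)

lemma has_lap_exp_linear:
  "has_lap (\<lambda>z. exp (a * Re z + b * Im z)) z ((a\<^sup>2 + b\<^sup>2) * exp (a * Re z + b * Im z))"
  unfolding has_lap_def
  using has_d2_exp_linear[of a b z 1] has_d2_exp_linear[of a b z \<i>] by (force simp: algebra_simps)

lemma has_lap_gauss:
  "has_lap (\<lambda>z. exp (- a * (cmod (z - y))\<^sup>2)) z ((4 * a\<^sup>2 * (cmod (z - y))\<^sup>2 - 4 * a) * exp (- a * (cmod (z - y))\<^sup>2))"
proof -
  define X Y where "X = Re z - Re y" and "Y = Im z - Im y"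
  have n: "(cmod (z + of_real t * d - y))\<^sup>2 = (X + t * Re d)\<^sup>2 + (Y + t * Im d)\<^sup>2" for t d
    by (simp add: cmod_power2 X_def Y_def algebra_simps)
  have n0: "(cmod (z - y))\<^sup>2 = X\<^sup>2 + Y\<^sup>2" by (simp add: cmod_power2 X_def Y_def)
  have 1: "has_d2 (\<lambda>z. exp (- a * (cmod (z - y))\<^sup>2)) z 1 ((4 * a\<^sup>2 * X\<^sup>2 - 2 * a) * exp (- a * (X\<^sup>2 + Y\<^sup>2)))"
    unfolding has_d2_def n
    by (rule exI[of _ "\<lambda>t. (- 2 * a * (X + t)) * exp (- a * ((X + t)\<^sup>2 + Y\<^sup>2))"])
      (auto intro!: derivative_eq_intros always_eventually simp: power2_eq_square algebra_simps)
  have 2: "has_d2 (\<lambda>z. exp (- a * (cmod (z - y))\<^sup>2)) z \<i> ((4 * a\<^sup>2 * Y\<^sup>2 - 2 * a) * exp (- a * (X\<^sup>2 + Y\<^sup>2)))"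
    unfolding has_d2_def n
    by (rule exI[of _ "\<lambda>t. (- 2 * a * (Y + t)) * exp (- a * (X\<^sup>2 + (Y + t)\<^sup>2))"])
      (auto intro!: derivative_eq_intros always_eventually simp: power2_eq_square algebra_simps)
  show ?thesis unfolding has_lap_def n0 using 1 2
    by (intro exI conjI) (assumption+, simp add: algebra_simps)
qed

text \<open>The second derivative of \<open>Re f\<close> in direction \<open>d\<close> is
  \<open>Re (f'' * d\<^sup>2)\<close>, and the squares of \<open>1\<close> and \<open>\<i>\<close>
  cancel.\<close>

lemma has_lap_Re_holomorphic:
  assumes U: "open U" "z \<in> U"
    and f: "\<And>x. x \<in> U \<Longrightarrow> (f has_field_derivative f' x) (at x)"
    and f': "(f' has_field_derivative f'') (at z)"
  shows "has_lap (\<lambda>z. Re (f z)) z 0"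
proof -
  have d2: "has_d2 (\<lambda>z. Re (f z)) z d (Re (f'' * d\<^sup>2))" for d
  proof -
    note c = filterlim_line[of z d]
    have vd: "((\<lambda>t::real. z + of_real t * d) has_vector_derivative d) (at t)" for t
      by (auto intro!: derivative_eq_intros simp: has_vector_derivative_def scaleR_conv_of_real)
    have *: "((\<lambda>t. Re (g (z + of_real t * d))) has_real_derivative Re (d * g')) (at t)"
      if "(g has_field_derivative g') (at (z + of_real t * d))" for g g' t
    proof -
      have "((g \<circ> (\<lambda>t. z + of_real t * d)) has_vector_derivative d * g') (at t)"
        by (rule field_vector_diff_chain_at[OF vd that])
      from bounded_linear.has_vector_derivative[OF bounded_linear_Re this] show ?thesis
        by (simp add: o_def has_real_derivative_iff_has_vector_derivative)
    qed
    have "\<forall>\<^sub>F x in nhds z. x \<in> U" using U by (rule eventually_nhds_in_open)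
    from eventually_compose_filterlim[OF this c]
    have "\<forall>\<^sub>F t in nhds 0. ((\<lambda>t. Re (f (z + of_real t * d))) has_real_derivative Re (d * f' (z + of_real t * d))) (at t)"
      by eventually_elim (rule *[OF f])
    moreover have "((\<lambda>t. Re ((\<lambda>x. d * f' x) (z + of_real t * d))) has_real_derivative Re (d * (d * f''))) (at 0)"
      by (rule *) (use DERIV_cmult[OF f'] in auto)
    ultimately show ?thesis unfolding has_d2_def
      by (intro exI[of _ "\<lambda>t. Re (d * f' (z + of_real t * d))"]) (auto simp: power2_eq_square mult_ac)
  qed
  show ?thesis unfolding has_lap_def using d2[of 1] d2[of \<i>] by (force simp: power2_eq_square)
qed

lemma attains_min_closed:
  fixes g :: "complex \<Rightarrow> real"
  assumes "closed S" "continuous_on S g" "z0 \<in> S"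
    and out: "\<And>z. z \<in> S \<Longrightarrow> cmod z \<ge> K \<Longrightarrow> g z0 \<le> g z"
  obtains z where "z \<in> S" "\<And>x. x \<in> S \<Longrightarrow> g z \<le> g x"
proof -
  define M where "M = max K (cmod z0)"
  have "compact (S \<inter> cball 0 M)" using assms(1) by (simp add: closed_Int_compact)
  moreover have z0: "z0 \<in> S \<inter> cball 0 M" using assms by (auto simp: M_def)
  moreover have "continuous_on (S \<inter> cball 0 M) g" using assms(2) continuous_on_subset by blast
  ultimately obtain z where z: "z \<in> S \<inter> cball 0 M" "\<And>x. x \<in> S \<inter> cball 0 M \<Longrightarrow> g z \<le> g x"
    using continuous_attains_inf[of "S \<inter> cball 0 M" g] by blast
  have "g z \<le> g x" if "x \<in> S" for x
  proof (cases "x \<in> cball 0 M")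
    case True then show ?thesis using z that by auto
  next
    case False
    then have "g z0 \<le> g x" using that by (intro out) (auto simp: M_def)
    with z(2)[OF z0] show ?thesis by simp
  qed
  with z show ?thesis using that by blast
qed

lemma filterlim_norm_bound:
  fixes g :: "complex \<Rightarrow> real"
  assumes "filterlim h at_top at_top" "\<And>z. z \<in> S \<Longrightarrow> g z \<ge> h (cmod z)"
  obtains K where "\<And>z. z \<in> S \<Longrightarrow> cmod z \<ge> K \<Longrightarrow> c \<le> g z"
proof -
  from assms(1) have "\<forall>\<^sub>F x in at_top. c \<le> h x" by (simp add: filterlim_at_top)
  then obtain K where "\<And>x. x \<ge> K \<Longrightarrow> c \<le> h x" unfolding eventually_at_top_linorder by blast
  then show ?thesis using that[of K] assms(2) by (meson order_trans)
qed

text \<open>A Phragmen--Lindelof principle; the barrier is \<open>Re \<surd>(\<lambda> + 1 - z)\<close>, which is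
  harmonic and outgrows the logarithm, made strictly superharmonic by a bounded term.\<close>

lemma half_plane_minimum:
  assumes cont: "continuous_on {z. Re z \<le> l} Z"
    and lap: "\<And>z. Re z < l \<Longrightarrow> \<exists>a\<le>0. has_lap Z z a"
    and bd: "\<And>z. Re z = l \<Longrightarrow> 0 \<le> Z z"
    and low: "\<And>z. Re z \<le> l \<Longrightarrow> - K - K * ln (1 + cmod z) \<le> Z z"
    and z: "Re z \<le> l"
  shows "0 \<le> Z z"
proof (rule ccontr)
  assume neg: "\<not> 0 \<le> Z z"
  \<comment> \<open>The branch point sits at \<open>l + 1\<close>, one unit outside the half-plane,
    so the root is smooth up to the boundary and \<open>B\<close> is positive there.\<close>
  define B where "B = (\<lambda>z. Re (csqrt (of_real (l + 1) - z)) + (exp l - exp (Re z)))"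
  have Bpos: "B x > 0" if "Re x \<le> l" for x
  proof -
    have "Re (csqrt (of_real (l + 1) - x)) > 0"
      using that complex_Re_le_cmod[of "of_real (l + 1) - x"]
      by (subst csqrt.sel) (auto simp: add_nonneg_pos norm_ge_zero intro!: add_nonneg_pos)
    moreover have "exp l - exp (Re x) \<ge> 0" using that by simp
    ultimately show ?thesis unfolding B_def by linarith
  qed
  have Blow: "sqrt ((cmod x - (\<bar>l\<bar> + 1)) / 2) \<le> B x" if "Re x \<le> l" for x
  proof -
    have "cmod x \<le> cmod (of_real (l + 1) - x) + cmod (of_real (l + 1))"
      by (metis norm_minus_commute norm_triangle_sub add.commute)
    then have "cmod x - (\<bar>l\<bar> + 1) \<le> cmod (of_real (l + 1) - x)"
      unfolding norm_of_real by linarith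
    then have "sqrt ((cmod x - (\<bar>l\<bar> + 1)) / 2) \<le> Re (csqrt (of_real (l + 1) - x))"
      using that by (subst csqrt.sel) (auto)
    moreover have "exp l - exp (Re x) \<ge> 0" using that by simp
    ultimately show ?thesis unfolding B_def by linarith
  qed
  have Blap: "has_lap B x (- exp (Re x))" if "Re x \<le> l" for x
  proof -
    have "has_lap (\<lambda>z. Re (csqrt (of_real (l + 1) - z))) x 0"
    proof (rule has_lap_Re_holomorphic[where U = "{z. Re z < l + 1}"])
      show "open {z. Re z < l + 1}" by (rule open_halfspace_Re_lt)
      show "x \<in> {z. Re z < l + 1}" using that by simp
      have np: "of_real (l + 1) - y \<notin> \<real>\<^sub>\<le>\<^sub>0" if "Re y < l + 1" for y
        using that by (auto simp: complex_nonpos_Reals_iff)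
      show "((\<lambda>z. csqrt (of_real (l + 1) - z)) has_field_derivative - (inverse (2 * csqrt (of_real (l + 1) - y)))) (at y)"
        if "y \<in> {z. Re z < l + 1}" for y
        by (rule derivative_eq_intros np refl | use that np in \<open>force simp: field_simps\<close>)+
      have "csqrt (of_real (l + 1) - x) \<noteq> 0" using that by auto
      then show "((\<lambda>y. - (inverse (2 * csqrt (of_real (l + 1) - y)))) has_field_derivative
          - (inverse (4 * csqrt (of_real (l + 1) - x) ^ 3))) (at x)"
        by - (rule derivative_eq_intros np refl | use that np in \<open>force simp: field_simps power3_eq_cube\<close>)+
    qed
    moreover have "has_lap (\<lambda>z. exp l - exp (Re z)) x (0 - exp (Re x))"
      using has_lap_diff[OF has_lap_const has_lap_exp_linear[of 1 0]] by simp
    ultimately show ?thesis using has_lap_add unfolding B_def by fastforce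
  qed
  \<comment> \<open>Half of the negative value \<open>Z z\<close> survives the addition of
    \<open>e * B z\<close>, so the minimum found below is negative.\<close>
  define e where "e = - Z z / (2 * B z)"
  have e: "e > 0" and eZ: "Z z + e * B z < 0"
    using neg Bpos[OF z] by (auto simp: e_def field_simps divide_neg_pos)
  define h where "h = (\<lambda>x. - K - K * ln (1 + x) + e * sqrt ((x - (\<bar>l\<bar> + 1)) / 2))"
  have h: "filterlim h at_top at_top"
    unfolding h_def using e by real_asymp
  have hl: "h (cmod x) \<le> Z x + e * B x" if "x \<in> {z. Re z \<le> l}" for x
    using low[of x] Blow[of x] that e unfolding h_def by (intro add_mono mult_left_mono) auto
  obtain R where R: "\<And>x. x \<in> {z. Re z \<le> l} \<Longrightarrow> cmod x \<ge> R \<Longrightarrow> Z z + e * B z \<le> Z x + e * B x"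
    using filterlim_norm_bound[OF h, of "{z. Re z \<le> l}" "\<lambda>x. Z x + e * B x" "Z z + e * B z"] hl by blast
  have "continuous_on {z. Re z > 0} csqrt"
    by (intro continuous_at_imp_continuous_on ballI continuous_at_csqrt) (auto simp: complex_nonpos_Reals_iff)
  from continuous_on_compose2[OF this, of "{z. Re z \<le> l}" "\<lambda>z. of_real (l + 1) - z"]
  have "continuous_on {z. Re z \<le> l} (\<lambda>z. csqrt (of_real (l + 1) - z))"
    by (force intro!: continuous_intros)
  then have contB: "continuous_on {z. Re z \<le> l} B"
    unfolding B_def by (intro continuous_intros)
  obtain y where y: "Re y \<le> l" "\<And>x. Re x \<le> l \<Longrightarrow> Z y + e * B y \<le> Z x + e * B x"
  proof (rule attains_min_closed[of "{z. Re z \<le> l}" "\<lambda>x. Z x + e * B x" z R])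
    show "continuous_on {z. Re z \<le> l} (\<lambda>x. Z x + e * B x)"
      by (intro continuous_intros cont contB)
  qed (use R z in \<open>auto simp: closed_halfspace_Re_le\<close>)
  have yneg: "Z y + e * B y < 0" using y(2)[OF z] eZ by linarith
  have "Re y < l"
  proof (rule ccontr)
    assume "\<not> Re y < l"
    then have "Z y \<ge> 0" using y bd by simp
    moreover have "e * B y > 0" using e Bpos[OF y(1)] by simp
    ultimately show False using yneg by linarith
  qed
  then obtain a where a: "a \<le> 0" "has_lap Z y a" using lap by blast
  have "has_lap (\<lambda>x. Z x + e * B x) y (a + e * (- exp (Re y)))"
    by (intro has_lap_add has_lap_cmult a Blap y)
  moreover have "\<forall>\<^sub>F x in nhds y. Z y + e * B y \<le> Z x + e * B x"
  proof -
    have "\<forall>\<^sub>F x in nhds y. x \<in> {z. Re z < l}"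
      using \<open>Re y < l\<close> by (intro eventually_nhds_in_open open_halfspace_Re_lt) auto
    then show ?thesis by eventually_elim (use y in auto)
  qed
  ultimately have "0 \<le> a + e * (- exp (Re y))" by (rule has_lap_local_min)
  moreover have "e * exp (Re y) > 0" using e by simp
  ultimately show False using a by simp
qed

text \<open>On the annulus between radii \<open>r / 2\<close> and \<open>r\<close>, \<open>F\<close>
  dominates \<open>m * (g - k)\<close>: \<open>g\<close> is a Gaussian about \<open>y\<close>,
  \<open>k\<close> its value on the outer circle, and \<open>m\<close> the minimum of
  \<open>F\<close> on the inner disc. The Gaussian difference grows linearly along the inner normal,
  hence so does \<open>F\<close>.\<close>

lemma hopf_boundary_growth:
  assumes r: "0 < r" and cont: "continuous_on (cball y r) F"
    and nn: "\<And>z. z \<in> cball y r \<Longrightarrow> 0 \<le> F z" and pos: "\<And>z. z \<in> ball y r \<Longrightarrow> 0 < F z"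
    and lap: "\<And>z. z \<in> ball y r \<Longrightarrow> \<exists>l. has_lap F z l \<and> l \<le> C * F z"
    and x: "cmod (x - y) = r"
  obtains c where "c > 0" "\<And>t. 0 \<le> t \<Longrightarrow> t \<le> 1/2 \<Longrightarrow> c * t \<le> F (x + of_real t * (y - x))"
proof -
  \<comment> \<open>\<open>D\<close> may replace \<open>C\<close> because \<open>F\<close> is
    positive in the disc, and its own positivity decides the sign at the end.
    \<open>\<alpha>\<close> is so large that the Laplacian of \<open>g\<close> exceeds
    \<open>D * g\<close> on the annulus.\<close>
  define D where "D = max C 1"
  define \<alpha> where "\<alpha> = max 1 ((5 + D) / r\<^sup>2)"
  define g where "g = (\<lambda>z. exp (- \<alpha> * (cmod (z - y))\<^sup>2))"
  define k where "k = exp (- \<alpha> * r\<^sup>2)"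
  have D: "D \<ge> 1" "D \<ge> C" by (auto simp: D_def)
  have \<alpha>: "\<alpha> \<ge> 1" "\<alpha> * r\<^sup>2 \<ge> 5 + D"
    using r by (auto simp: \<alpha>_def field_simps max_def)
  have glap: "has_lap g z ((4 * \<alpha>\<^sup>2 * (cmod (z - y))\<^sup>2 - 4 * \<alpha>) * g z)" for z
    unfolding g_def by (rule has_lap_gauss)
  have big: "D < 4 * \<alpha>\<^sup>2 * (cmod (z - y))\<^sup>2 - 4 * \<alpha>" if "r / 2 \<le> cmod (z - y)" for z
  proof -
    have "(r / 2)\<^sup>2 \<le> (cmod (z - y))\<^sup>2" using that r by (intro power_mono) auto
    then have "4 * \<alpha>\<^sup>2 * (r / 2)\<^sup>2 \<le> 4 * \<alpha>\<^sup>2 * (cmod (z - y))\<^sup>2" by (intro mult_left_mono) auto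
    moreover have "4 * \<alpha>\<^sup>2 * (r / 2)\<^sup>2 = \<alpha> * (\<alpha> * r\<^sup>2)" by (simp add: power2_eq_square)
    moreover have "\<alpha> * (\<alpha> * r\<^sup>2) \<ge> \<alpha> * (5 + D)" using \<alpha> by (intro mult_left_mono) auto
    moreover have "\<alpha> * (1 + D) \<ge> 1 * (1 + D)" using \<alpha> D by (intro mult_right_mono) auto
    ultimately show ?thesis by (simp add: algebra_simps)
  qed
  have sub: "cball y (r / 2) \<subseteq> ball y r" using r by auto
  have "compact (cball y (r / 2))" "cball y (r / 2) \<noteq> {}" using r by auto
  moreover have "continuous_on (cball y (r / 2)) F"
    by (rule continuous_on_subset[OF cont]) (use r in \<open>simp add: subset_cball\<close>)
  ultimately obtain p where p: "p \<in> cball y (r / 2)" "\<And>z. z \<in> cball y (r / 2) \<Longrightarrow> F p \<le> F z"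
    using continuous_attains_inf[of "cball y (r / 2)" F] by blast
  define m where "m = F p"
  have m: "m > 0" using pos p sub unfolding m_def by blast
  define V where "V = (\<lambda>z. F z - m * (g z - k))"
  define S where "S = cball y r - ball y (r / 2)"
  have gle: "g z \<le> 1" for z unfolding g_def using \<alpha> by simp
  have kpos: "k > 0" by (simp add: k_def)
  have V: "V z \<ge> 0" if zS: "z \<in> S" for z
  proof (rule ccontr)
    assume neg: "\<not> V z \<ge> 0"
    have "compact S" unfolding S_def by (simp add: compact_diff)
    moreover have "continuous_on S F" using cont by (rule continuous_on_subset) (auto simp: S_def)
    then have "continuous_on S V" unfolding V_def g_def by (intro continuous_intros)
    ultimately obtain q where q: "q \<in> S" "\<And>z. z \<in> S \<Longrightarrow> V q \<le> V z"
      using continuous_attains_inf[of S V] zS by blast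
    have qneg: "V q < 0" using q(2)[OF zS] neg by linarith
    have qr: "r / 2 \<le> cmod (q - y)" "cmod (q - y) \<le> r"
      using q(1) by (auto simp: S_def dist_norm norm_minus_commute)
    have 1: "cmod (q - y) \<noteq> r"
    proof
      assume "cmod (q - y) = r"
      then have "V q = F q" by (simp add: V_def g_def k_def)
      moreover have "F q \<ge> 0" using nn q(1) by (auto simp: S_def)
      ultimately show False using qneg by simp
    qed
    have 2: "cmod (q - y) \<noteq> r / 2"
    proof
      assume "cmod (q - y) = r / 2"
      then have "q \<in> cball y (r / 2)" by (simp add: dist_norm norm_minus_commute)
      then have "F q \<ge> m" using p m_def by blast
      moreover have "m * (g q - k) \<le> m * 1" using m gle[of q] kpos by (intro mult_left_mono) linarith+
      ultimately show False using qneg by (simp add: V_def)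
    qed
    have qb: "q \<in> ball y r" using qr 1 by (simp add: dist_norm norm_minus_commute)
    then obtain l where l: "has_lap F q l" "l \<le> C * F q" using lap by blast
    have op: "open (ball y r - cball y (r / 2))" by auto
    have "q \<in> ball y r - cball y (r / 2)" using qr 1 2 by (simp add: dist_norm norm_minus_commute)
    from eventually_nhds_in_open[OF op this]
    have "\<forall>\<^sub>F z in nhds q. V q \<le> V z"
      by eventually_elim (rule q(2), auto simp: S_def)
    moreover have "has_lap V q (l - m * ((4 * \<alpha>\<^sup>2 * (cmod (q - y))\<^sup>2 - 4 * \<alpha>) * g q - 0))"
      unfolding V_def by (intro has_lap_diff has_lap_cmult has_lap_const l glap)
    ultimately have "0 \<le> l - m * ((4 * \<alpha>\<^sup>2 * (cmod (q - y))\<^sup>2 - 4 * \<alpha>) * g q)"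
      using has_lap_local_min by fastforce
    moreover have "m * (D * g q) \<le> m * ((4 * \<alpha>\<^sup>2 * (cmod (q - y))\<^sup>2 - 4 * \<alpha>) * g q)"
      using m big[OF qr(1)] by (intro mult_left_mono mult_right_mono) (auto simp: g_def)
    moreover have "C * F q \<le> D * F q" using D pos[OF qb] by (intro mult_right_mono) auto
    \<comment> \<open>The test at the negative minimum of \<open>V\<close> becomes
      \<open>0 \<le> D * V q - m * D * k\<close>, whose right side is negative.\<close>
    ultimately have "0 \<le> D * F q - m * (D * g q)" using l by linarith
    also have "\<dots> = D * (V q) - m * D * k" by (simp add: V_def algebra_simps)
    finally have "D * V q \<ge> m * D * k" by simp
    moreover have "m * D * k > 0" using m D kpos by simp
    moreover have "D * V q < 0" using D qneg by (simp add: mult_pos_neg)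
    ultimately show False by linarith
  qed
  \<comment> \<open>This rate results from \<open>exp s \<ge> 1 + s\<close> and
    \<open>2 * t - t\<^sup>2 \<ge> t\<close> for \<open>t\<close> between 0 and 1.\<close>
  define c where "c = m * k * (\<alpha> * r\<^sup>2)"
  have "c > 0" unfolding c_def using m kpos \<alpha> r by simp
  moreover have "c * t \<le> F (x + of_real t * (y - x))" if t: "0 \<le> t" "t \<le> 1/2" for t
  proof -
    let ?z = "x + of_real t * (y - x)"
    have "?z - y = of_real (1 - t) * (x - y)" by (simp add: algebra_simps)
    then have nz: "cmod (?z - y) = (1 - t) * r" using t x by (simp add: norm_mult del: of_real_diff)
    have "(1 - t) * r \<le> r" "r / 2 \<le> (1 - t) * r" using t r by (auto simp: field_simps mult_left_le)
    then have "?z \<in> S" unfolding S_def using nz by (auto simp: dist_norm norm_minus_commute)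
    from V[OF this] have "m * (g ?z - k) \<le> F ?z" by (simp add: V_def)
    moreover have "c * t \<le> m * (g ?z - k)"
    proof -
      have "g ?z = k * exp (\<alpha> * r\<^sup>2 * (2 * t - t\<^sup>2))"
        unfolding g_def nz k_def exp_add[symmetric] by (simp add: power_mult_distrib power2_eq_square algebra_simps)
      moreover have "1 + \<alpha> * r\<^sup>2 * t \<le> exp (\<alpha> * r\<^sup>2 * (2 * t - t\<^sup>2))"
      proof -
        have "1 + \<alpha> * r\<^sup>2 * (2 * t - t\<^sup>2) \<le> exp (\<alpha> * r\<^sup>2 * (2 * t - t\<^sup>2))" by (rule exp_ge_add_one_self)
        moreover have "\<alpha> * r\<^sup>2 * t \<le> \<alpha> * r\<^sup>2 * (2 * t - t\<^sup>2)"
          using \<alpha> t by (intro mult_left_mono) (auto simp: power2_eq_square mult_left_le)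
        ultimately show ?thesis by linarith
      qed
      ultimately have "k * (1 + \<alpha> * r\<^sup>2 * t) \<le> g ?z" using kpos by (simp add: mult_left_mono)
      then have "k * (\<alpha> * r\<^sup>2 * t) \<le> g ?z - k" by (simp add: algebra_simps)
      then have "m * (k * (\<alpha> * r\<^sup>2 * t)) \<le> m * (g ?z - k)" using m by (intro mult_left_mono) auto
      then show ?thesis by (simp add: c_def mult_ac)
    qed
    ultimately show ?thesis by linarith
  qed
  ultimately show ?thesis using that by blast
qed

lemma line_derivative:
  fixes F :: "complex \<Rightarrow> real"
  assumes "(F has_derivative F') (at x)"
  shows "((\<lambda>t. F (x + of_real t * d)) has_real_derivative F' d) (at 0)"
proof -
  have "((\<lambda>t::real. x + of_real t * d) has_derivative (\<lambda>t. of_real t * d)) (at 0)"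
    by (auto intro!: derivative_eq_intros)
  moreover have "(F has_derivative F') (at (x + of_real 0 * d))" using assms by simp
  ultimately have "((\<lambda>t. F (x + of_real t * d)) has_derivative (\<lambda>t. F' (of_real t * d))) (at 0)"
    by (rule has_derivative_compose)
  moreover have "F' (of_real t * d) = F' d * t" for t
  proof -
    interpret bounded_linear F' using assms by (rule has_derivative_bounded_linear)
    show ?thesis using scaleR[of t d] by (simp add: scaleR_conv_of_real mult.commute)
  qed
  ultimately show ?thesis by (simp add: has_field_derivative_def)
qed

lemma linear_growth_deriv_pos:
  fixes \<phi> :: "real \<Rightarrow> real"
  assumes "(\<phi> has_real_derivative D) (at 0)" "\<phi> 0 = 0" "c > 0"
    and "\<And>t. 0 \<le> t \<Longrightarrow> t \<le> 1/2 \<Longrightarrow> c * t \<le> \<phi> t"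
  shows "D > 0"
proof (rule ccontr)
  assume "\<not> D > 0"
  moreover have "((\<lambda>t. \<phi> t - c * t) has_real_derivative D - c) (at 0)"
    by (auto intro!: derivative_eq_intros assms)
  ultimately obtain e where e: "e > 0" "\<And>h. 0 < h \<Longrightarrow> h < e \<Longrightarrow> \<phi> (0 + h) - c * (0 + h) < \<phi> 0 - c * 0"
    using DERIV_neg_dec_right[of "\<lambda>t. \<phi> t - c * t" "D - c" 0] assms(3) by fastforce
  define h where "h = min (e / 2) (1 / 2)"
  have "0 < h" "h < e" "h \<le> 1/2" using e by (auto simp: h_def)
  then show False using e(2)[of h] assms(2) assms(4)[of h] by simp
qed

text \<open>Shortly before the first zero on the segment from \<open>b\<close> to \<open>a\<close>
  there is a point \<open>y\<close> with \<open>F y\<close> nonzero; the largest open disc about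
  \<open>y\<close> without zeros has a zero \<open>x\<close> on its boundary. Hopf's lemma makes the
  derivative at \<open>x\<close> towards \<open>y\<close> positive, but at an interior minimum it is
  zero. The constant \<open>C\<close> may vary with the disc, since it will contain a local bound on
  the unbounded function \<open>w\<close>.\<close>

lemma strong_minimum_principle:
  assumes nn: "\<And>z. Re z < l \<Longrightarrow> 0 \<le> F z"
    and diff: "\<And>z. Re z < l \<Longrightarrow> F differentiable (at z)"
    and lap: "\<And>y r. 0 < r \<Longrightarrow> cball y r \<subseteq> {z. Re z < l} \<Longrightarrow>
        \<exists>C. \<forall>z\<in>ball y r. \<exists>a. has_lap F z a \<and> a \<le> C * F z"
    and a: "Re a < l" "F a = 0" and b: "Re b < l"
  shows "F b = 0"
proof (rule ccontr)
  assume "F b \<noteq> 0"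
  have cont: "continuous_on {z. Re z < l} F"
    using diff by (auto intro!: continuous_at_imp_continuous_on differentiable_imp_continuous_within)
  define \<gamma> where "\<gamma> = (\<lambda>t::real. b + of_real t * (a - b))"
  \<comment> \<open>The distance of the segment from the boundary line. Half of it is spent on the
    step back from the first zero to \<open>y\<close>, which also bounds the radius of the touching
    disc.\<close>
  define d where "d = l - max (Re a) (Re b)"
  have d: "d > 0" using a b by (simp add: d_def)
  have Re\<gamma>: "Re (\<gamma> t) \<le> max (Re a) (Re b)" if "0 \<le> t" "t \<le> 1" for t
  proof -
    have "Re (\<gamma> t) = t * Re a + (1 - t) * Re b" by (simp add: \<gamma>_def algebra_simps)
    also have "\<dots> \<le> t * max (Re a) (Re b) + (1 - t) * max (Re a) (Re b)"
      using that by (intro add_mono mult_left_mono) auto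
    finally show ?thesis by (simp add: algebra_simps)
  qed
  have inH: "Re z < l" if "0 \<le> t" "t \<le> 1" "dist (\<gamma> t) z < d" for t z
  proof -
    have "\<bar>Re (z - \<gamma> t)\<bar> \<le> cmod (z - \<gamma> t)" by (rule abs_Re_le_cmod)
    then have "Re z - Re (\<gamma> t) < d" using that(3) by (simp add: dist_norm norm_minus_commute)
    with Re\<gamma>[OF that(1,2)] show ?thesis unfolding d_def by linarith
  qed
  have Hs: "Re (\<gamma> t) < l" if "0 \<le> t" "t \<le> 1" for t using inH[OF that, of "\<gamma> t"] d by simp
  have c\<gamma>: "continuous_on {0..1} (\<lambda>t. F (\<gamma> t))"
    by (rule continuous_on_compose2[OF cont]) (auto simp: \<gamma>_def intro!: continuous_intros Hs[unfolded \<gamma>_def])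
  define T where "T = {t \<in> {0..1}. F (\<gamma> t) = 0}"
  have "compact T"
  proof -
    have "closed T" unfolding T_def
      by (intro continuous_closed_preimage_constant c\<gamma>) simp
    moreover have "bounded T" by (rule bounded_subset[of "{0..1}"]) (auto simp: T_def)
    ultimately show ?thesis by (simp add: compact_eq_bounded_closed)
  qed
  moreover have "1 \<in> T" using a by (simp add: T_def \<gamma>_def)
  ultimately obtain t0 where t0: "t0 \<in> T" "\<And>t. t \<in> T \<Longrightarrow> t0 \<le> t"
    using compact_attains_inf[of T] by blast
  have t0': "0 < t0" "t0 \<le> 1" "F (\<gamma> t0) = 0"
    using t0(1) \<open>F b \<noteq> 0\<close> by (auto simp: T_def \<gamma>_def less_le)
  have "isCont \<gamma> t0" unfolding \<gamma>_def by (intro continuous_intros)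
  then obtain e where e: "e > 0" "\<And>t. dist t t0 < e \<Longrightarrow> dist (\<gamma> t) (\<gamma> t0) < d / 2"
    using d unfolding continuous_at_eps_delta by (meson half_gt_zero)
  define t1 where "t1 = max 0 (t0 - e / 2)"
  have t1: "0 \<le> t1" "t1 < t0" "t1 \<le> 1" "dist t1 t0 < e" using t0' e by (auto simp: t1_def dist_real_def)
  define y where "y = \<gamma> t1"
  have yt0: "dist y (\<gamma> t0) < d / 2" using e(2)[OF t1(4)] by (simp add: y_def)
  have "t1 \<notin> T" using t0(2) t1 by force
  then have Fy: "F y \<noteq> 0" using t1 by (simp add: T_def y_def)
  have ycb: "cball y (d / 2) \<subseteq> {z. Re z < l}" using inH[OF t1(1,3)] d by (auto simp: y_def)
  define Zs where "Zs = {z \<in> cball y (d / 2). F z = 0}"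
  have "continuous_on (cball y (d / 2)) F" using cont ycb by (rule continuous_on_subset)
  then have "closed Zs" unfolding Zs_def by (intro continuous_closed_preimage_constant) auto
  moreover have "bounded Zs" by (rule bounded_subset[of "cball y (d / 2)"]) (auto simp: Zs_def)
  ultimately have "compact Zs" by (simp add: compact_eq_bounded_closed)
  moreover have "\<gamma> t0 \<in> Zs" using t0' yt0 by (simp add: Zs_def)
  ultimately obtain x where x: "x \<in> Zs" "\<And>z. z \<in> Zs \<Longrightarrow> dist y x \<le> dist y z"
    using continuous_attains_inf[of Zs "dist y"] by (force intro: continuous_intros)
  define r where "r = dist y x"
  have xx: "F x = 0" "dist y x \<le> d / 2" using x by (auto simp: Zs_def)
  have r: "r > 0" "r \<le> d / 2" using xx Fy by (auto simp: r_def)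
  have sub: "cball y r \<subseteq> {z. Re z < l}"
    using ycb r by (meson order_trans subset_cball)
  obtain C where C: "\<And>z. z \<in> ball y r \<Longrightarrow> \<exists>a. has_lap F z a \<and> a \<le> C * F z"
    using lap[OF r(1) sub] by blast
  obtain c where c: "c > 0" "\<And>t. 0 \<le> t \<Longrightarrow> t \<le> 1/2 \<Longrightarrow> c * t \<le> F (x + of_real t * (y - x))"
  proof (rule hopf_boundary_growth[OF r(1), of y F C x])
    show "continuous_on (cball y r) F" using cont sub by (rule continuous_on_subset)
    show "0 \<le> F z" if "z \<in> cball y r" for z using sub that nn by blast
    show "0 < F z" if "z \<in> ball y r" for z
    proof -
      have "F z \<noteq> 0"
      proof
        assume "F z = 0"
        then have "z \<in> Zs" using that r by (auto simp: Zs_def)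
        from x(2)[OF this] that show False by (simp add: r_def)
      qed
      moreover have "0 \<le> F z" using sub that nn by force
      ultimately show ?thesis by simp
    qed
    show "cmod (x - y) = r" by (simp add: r_def dist_norm norm_minus_commute)
  qed (use C in auto)
  have xH: "Re x < l" using sub by (auto simp: r_def)
  then obtain F' where F': "(F has_derivative F') (at x)" using diff unfolding differentiable_def by blast
  note l = line_derivative[OF F', of "y - x"]
  from linear_growth_deriv_pos[OF l _ c] xx have "F' (y - x) > 0" by simp
  moreover have "F' (y - x) = 0"
  proof -
    have "\<forall>\<^sub>F z in nhds x. z \<in> {z. Re z < l}"
      using xH by (intro eventually_nhds_in_open open_halfspace_Re_lt) auto
    from eventually_compose_filterlim[OF this filterlim_line[of x "y - x"]]
    obtain e where e: "e > 0" "\<And>t. \<bar>t\<bar> < e \<Longrightarrow> Re (x + of_real t * (y - x)) < l"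
      unfolding eventually_nhds_metric by (auto simp: dist_real_def)
    show ?thesis
      by (rule DERIV_local_min[OF l e(1)]) (use e(2) nn xx in auto)
  qed
  ultimately show False by simp
qed

text \<open>\<open>F1\<close>, \<open>F2\<close> are the first partial derivatives and
  \<open>F11\<close>, \<open>F22\<close> the pure second ones, given as functions so that integrals
  and limits can refer to them directly.\<close>

definition c2fun :: "(complex \<Rightarrow> real) \<Rightarrow> (complex \<Rightarrow> real) \<Rightarrow> (complex \<Rightarrow> real) \<Rightarrow> (complex \<Rightarrow> real) \<Rightarrow> (complex \<Rightarrow> real) \<Rightarrow> bool"
  where "c2fun F F1 F2 F11 F22 \<longleftrightarrow>
    (\<forall>z. (F has_derivative (\<lambda>h. F1 z * Re h + F2 z * Im h)) (at z)) \<and>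
    (\<forall>z. ((\<lambda>t. F1 (z + of_real t)) has_real_derivative F11 z) (at 0)) \<and>
    (\<forall>z. ((\<lambda>t. F2 (z + of_real t * \<i>)) has_real_derivative F22 z) (at 0)) \<and>
    continuous_on UNIV F1 \<and> continuous_on UNIV F2 \<and> continuous_on UNIV F11 \<and> continuous_on UNIV F22"

lemma deriv_along_line:
  fixes G G' :: "complex \<Rightarrow> real"
  assumes "\<And>z. ((\<lambda>t. G (z + of_real t * d)) has_real_derivative G' z) (at 0)"
  shows "((\<lambda>t. G (z + of_real t * d)) has_real_derivative G' (z + of_real t * d)) (at t)"
proof -
  have "((\<lambda>h. G (z + of_real t * d + of_real h * d)) has_real_derivative G' (z + of_real t * d)) (at 0)"
    by (rule assms)
  then have "((\<lambda>h. G (z + of_real (h + t) * d)) has_real_derivative G' (z + of_real t * d)) (at 0)"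
    by (simp add: algebra_simps)
  then show ?thesis using DERIV_at_within_shift[of "\<lambda>t. G (z + of_real t * d)" _ t 0 UNIV]
    by (simp add: add.commute)
qed

lemma c2fun_has_lap:
  assumes "c2fun F F1 F2 F11 F22"
  shows "has_lap F z (F11 z + F22 z)"
proof -
  have F: "\<And>z. (F has_derivative (\<lambda>h. F1 z * Re h + F2 z * Im h)) (at z)"
    and 1: "\<And>z. ((\<lambda>t. F1 (z + of_real t * 1)) has_real_derivative F11 z) (at 0)"
    and 2: "\<And>z. ((\<lambda>t. F2 (z + of_real t * \<i>)) has_real_derivative F22 z) (at 0)"
    using assms by (auto simp: c2fun_def)
  have "((\<lambda>t. F (z + of_real t * 1)) has_real_derivative F1 z) (at 0)" for z
    using line_derivative[OF F, of z 1] by simp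
  from deriv_along_line[OF this] have "has_d2 F z 1 (F11 z)"
    unfolding has_d2_def using 1 by (intro exI[of _ "\<lambda>t. F1 (z + of_real t * 1)"]) (auto intro!: always_eventually)
  moreover have "((\<lambda>t. F (z + of_real t * \<i>)) has_real_derivative F2 z) (at 0)" for z
    using line_derivative[OF F, of z \<i>] by simp
  from deriv_along_line[OF this] have "has_d2 F z \<i> (F22 z)"
    unfolding has_d2_def using 2 by (intro exI[of _ "\<lambda>t. F2 (z + of_real t * \<i>)"]) (auto intro!: always_eventually)
  ultimately show ?thesis unfolding has_lap_def by blast
qed

lemma c2fun_continuous:
  assumes "c2fun F F1 F2 F11 F22"
  shows "continuous_on S F"
proof -
  have "\<And>z. (F has_derivative (\<lambda>h. F1 z * Re h + F2 z * Im h)) (at z)" using assms by (auto simp: c2fun_def)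
  then show ?thesis by (meson continuous_at_imp_continuous_on has_derivative_continuous)
qed

lemma c2fun_affine:
  assumes "c2fun F F1 F2 F11 F22"
  shows "c2fun (\<lambda>z. c - F z) (\<lambda>z. - F1 z) (\<lambda>z. - F2 z) (\<lambda>z. - F11 z) (\<lambda>z. - F22 z)"
  using assms unfolding c2fun_def
  by (auto intro!: derivative_eq_intros continuous_intros DERIV_minus)

section \<open>Growth of nonnegative subharmonic functions\<close>

abbreviation Box :: "(real \<times> real) set" where "Box \<equiv> cbox (-1, -1) (1, 1)"

text \<open>With its companion for the second variable, this is the divergence theorem for fields
  vanishing on the edges of the box; it performs the integration by parts for the averages. Fubini
  puts the differentiated variable innermost.\<close>

lemma integral_partial_fst_0:
  fixes \<phi> \<phi>' :: "real \<times> real \<Rightarrow> real"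
  assumes c: "continuous_on UNIV \<phi>'"
    and d: "\<And>s t. ((\<lambda>s. \<phi> (s, t)) has_real_derivative \<phi>' (s, t)) (at s)"
    and z: "\<And>t. \<phi> (1, t) = 0" "\<And>t. \<phi> (-1, t) = 0"
  shows "integral Box \<phi>' = 0"
proof -
  have c': "continuous_on S \<phi>'" for S using c continuous_on_subset by blast
  have in0: "integral (cbox (-1) 1) (\<lambda>s. \<phi>' (s, t)) = 0" for t
  proof -
    have "((\<lambda>s. \<phi>' (s, t)) has_integral \<phi> (1, t) - \<phi> (-1, t)) {-1..1}"
      by (rule fundamental_theorem_of_calculus)
         (auto intro!: DERIV_subset[OF d] simp: has_real_derivative_iff_has_vector_derivative[symmetric])
    then show ?thesis using z by (simp add: integral_unique)
  qed
  have "integral Box \<phi>' = integral (cbox (-1) 1) (\<lambda>s. integral (cbox (-1) 1) (\<lambda>t. \<phi>' (s, t)))"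
    by (rule integral_prod_continuous[OF c'])
  also have "\<dots> = integral (cbox (-1) 1) (\<lambda>t. integral (cbox (-1) 1) (\<lambda>s. \<phi>' (s, t)))"
    by (rule integral_swap_continuous) (use c' in \<open>simp add: case_prod_beta'\<close>)
  also have "\<dots> = 0" unfolding in0 by simp
  finally show ?thesis .
qed

lemma integral_partial_snd_0:
  fixes \<phi> \<phi>' :: "real \<times> real \<Rightarrow> real"
  assumes c: "continuous_on UNIV \<phi>'"
    and d: "\<And>s t. ((\<lambda>t. \<phi> (s, t)) has_real_derivative \<phi>' (s, t)) (at t)"
    and z: "\<And>s. \<phi> (s, 1) = 0" "\<And>s. \<phi> (s, -1) = 0"
  shows "integral Box \<phi>' = 0"
proof -
  have c': "continuous_on S \<phi>'" for S using c continuous_on_subset by blast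
  have in0: "integral (cbox (-1) 1) (\<lambda>t. \<phi>' (s, t)) = 0" for s
  proof -
    have "((\<lambda>t. \<phi>' (s, t)) has_integral \<phi> (s, 1) - \<phi> (s, -1)) {-1..1}"
      by (rule fundamental_theorem_of_calculus)
         (auto intro!: DERIV_subset[OF d] simp: has_real_derivative_iff_has_vector_derivative[symmetric])
    then show ?thesis using z by (simp add: integral_unique)
  qed
  have "integral Box \<phi>' = integral (cbox (-1) 1) (\<lambda>s. integral (cbox (-1) 1) (\<lambda>t. \<phi>' (s, t)))"
    by (rule integral_prod_continuous[OF c'])
  also have "\<dots> = 0" unfolding in0 by simp
  finally show ?thesis .
qed

text \<open>Squaring makes \<open>bump2\<close> differentiable across the unit circle, where
  \<open>bump\<close> has a corner. For \<open>x \<le> 0\<close> the difference quotient is squeezed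
  by \<open>max 0 z\<close>.\<close>

lemma DERIV_max0_square: "((\<lambda>x. (max 0 x)\<^sup>2 :: real) has_real_derivative 2 * max 0 x) (at x)"
proof -
  have "\<exists>g. (\<forall>z. (max 0 z)\<^sup>2 - (max 0 x)\<^sup>2 = g z * (z - x)) \<and> isCont g x \<and> g x = 2 * max 0 x"
  proof (cases "x \<le> 0")
    case True
    define g where "g = (\<lambda>z. if z = x then 0 else (max 0 z)\<^sup>2 / (z - x))"
    have le: "\<bar>g z\<bar> \<le> max 0 z" for z
      using True by (auto simp: g_def power2_eq_square field_simps max_def mult_nonneg_nonpos2)
    have "isCont g x"
    proof -
      have "(g \<longlongrightarrow> 0) (at x)"
      proof (rule tendsto_rabs_zero_cancel, rule tendsto_sandwich[of "\<lambda>z. 0" _ _ "\<lambda>z. max 0 z"])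
        have "((\<lambda>z. max 0 z) \<longlongrightarrow> max 0 x) (at x)" by (intro tendsto_intros)
        then show "((\<lambda>z. max 0 z) \<longlongrightarrow> 0) (at x)" using True by simp
      qed (use le in auto)
      then show ?thesis by (simp add: isCont_def g_def)
    qed
    then show ?thesis using True by (intro exI[of _ g]) (auto simp: g_def)
  next
    case False
    have "((\<lambda>x. (max 0 x)\<^sup>2) has_real_derivative 2 * x) (at x)"
    proof (rule DERIV_cong_ev[THEN iffD2, OF refl _ refl])
      show "\<forall>\<^sub>F y in nhds x. (max 0 y)\<^sup>2 = y\<^sup>2"
        using eventually_nhds_in_open[of "{0<..}" x] False by (auto elim!: eventually_mono)
      show "((\<lambda>y. y\<^sup>2) has_real_derivative 2 * x) (at x)" by (auto intro!: derivative_eq_intros)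
    qed
    then show ?thesis using False unfolding CARAT_DERIV by simp
  qed
  then show ?thesis by (simp add: CARAT_DERIV)
qed

definition bump :: "real \<times> real \<Rightarrow> real" where
  "bump y = max 0 (1 - (norm y)\<^sup>2)"

lemma bump_Pair: "bump (s, t) = max 0 (1 - s\<^sup>2 - t\<^sup>2)"
  by (simp add: bump_def norm_Pair algebra_simps)

lemma bump_continuous [continuous_intros]: "continuous_on S g \<Longrightarrow> continuous_on S (\<lambda>x. bump (g x))"
  unfolding bump_def by (intro continuous_intros)

lemma bump_nonneg: "0 \<le> bump y" and bump_le_1: "bump y \<le> 1"
  by (auto simp: bump_def)

text \<open>A potential for the bump: its gradient at \<open>y\<close> is \<open>- bump y\<close>
  times \<open>y\<close>. Hence the radial derivative of \<open>V\<close> against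
  \<open>bump\<close> turns into the Laplacian of \<open>V\<close> against \<open>bump2\<close> by
  integration by parts.\<close>

definition bump2 :: "real \<times> real \<Rightarrow> real" where "bump2 y = (bump y)\<^sup>2 / 4"

lemma bump2_DERIV_fst: "((\<lambda>s. bump2 (s, t)) has_real_derivative - s * bump (s, t)) (at s)"
proof -
  have "((\<lambda>s. 1 - s\<^sup>2 - t\<^sup>2) has_real_derivative - 2 * s) (at s)" by (auto intro!: derivative_eq_intros)
  from DERIV_cdivide[OF DERIV_chain'[OF this DERIV_max0_square], of 4] show ?thesis
    unfolding bump2_def bump_Pair by (simp add: mult.commute)
qed

lemma bump2_DERIV_snd: "((\<lambda>t. bump2 (s, t)) has_real_derivative - t * bump (s, t)) (at t)"
proof -
  have "((\<lambda>t. 1 - s\<^sup>2 - t\<^sup>2) has_real_derivative - 2 * t) (at t)" by (auto intro!: derivative_eq_intros)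
  from DERIV_cdivide[OF DERIV_chain'[OF this DERIV_max0_square], of 4] show ?thesis
    unfolding bump2_def bump_Pair by (simp add: mult.commute)
qed

lemma bump2_edge: "bump2 (1, t) = 0" "bump2 (-1, t) = 0" "bump2 (t, 1) = 0" "bump2 (t, -1) = 0"
  by (auto simp: bump2_def bump_Pair)

lemma bump2_nonneg: "0 \<le> bump2 y" and bump2_le_1: "bump2 y \<le> 1"
  using bump_nonneg[of y] bump_le_1[of y] power_le_one[of "bump y" 2] by (auto simp: bump2_def)

lemma bump_integral_pos: "integral Box bump > 0"
proof -
  let ?S = "cbox (-1/2, -1/2) (1/2, 1/2) :: (real \<times> real) set"
  have cb: "continuous_on S bump" for S using bump_continuous[OF continuous_on_id] by simp
  have 1: "measure lborel ?S = 1" by (simp add: content_Pair)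
  have "integral ?S (\<lambda>y. 1/2) \<le> integral ?S bump"
  proof (rule integral_le)
    show "1/2 \<le> bump y" if "y \<in> ?S" for y
    proof (cases y)
      case (Pair s t)
      then have "s\<^sup>2 \<le> (1/2)\<^sup>2" "t\<^sup>2 \<le> (1/2)\<^sup>2" using that by (auto intro!: abs_le_square_iff[THEN iffD1])
      then show ?thesis unfolding Pair bump_Pair by (simp add: power2_eq_square)
    qed
  qed (use cb in \<open>auto intro: integrable_continuous\<close>)
  moreover have "integral ?S bump \<le> integral Box bump"
    using cb bump_nonneg by (intro integral_subset_le) (auto intro: integrable_continuous)
  ultimately show ?thesis using 1 by simp
qed

text \<open>The weight is a product of functions of one variable, so the integral factors; each
  factor is \<open>2 * arctan R / R\<close>, which is below \<open>pi / R\<close>.\<close>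

lemma arctan_box_integral:
  assumes "R > 0"
  shows "integral Box (\<lambda>y. 1 / ((1 + (R * fst y)\<^sup>2) * (1 + (R * snd y)\<^sup>2))) \<le> pi\<^sup>2 / R\<^sup>2"
proof -
  have nz: "1 + (R * s)\<^sup>2 \<noteq> 0" for s by (metis add_pos_nonneg less_numeral_extra(1) less_numeral_extra(3) zero_le_power2)
  have "((\<lambda>s. 1 / (1 + (R * s)\<^sup>2)) has_integral arctan (R * 1) / R - arctan (R * (-1)) / R) {-1..1}"
  proof (rule fundamental_theorem_of_calculus)
    fix s :: real
    have "((\<lambda>s. arctan (R * s) / R) has_real_derivative 1 / (1 + (R * s)\<^sup>2)) (at s within {-1..1})"
      using assms by (auto intro!: derivative_eq_intros simp: inverse_eq_divide)
    then show "((\<lambda>s. arctan (R * s) / R) has_vector_derivative 1 / (1 + (R * s)\<^sup>2)) (at s within {-1..1})"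
      by (simp add: has_real_derivative_iff_has_vector_derivative)
  qed simp
  then have I: "integral (cbox (-1) 1) (\<lambda>s. 1 / (1 + (R * s)\<^sup>2)) = 2 * arctan R / R"
    by (simp add: integral_unique arctan_minus)
  have "integral Box (\<lambda>y. 1 / ((1 + (R * fst y)\<^sup>2) * (1 + (R * snd y)\<^sup>2))) =
     integral (cbox (-1) 1) (\<lambda>s. integral (cbox (-1) 1) (\<lambda>t. 1 / ((1 + (R * s)\<^sup>2)) * (1 / (1 + (R * t)\<^sup>2))))"
    by (subst integral_prod_continuous) (auto intro!: continuous_intros simp: nz)
  also have "\<dots> = (2 * arctan R / R)\<^sup>2"
    using I by (simp only: integral_mult_right integral_mult_left power2_eq_square)
  also have "\<dots> \<le> (pi / R)\<^sup>2"
    using assms arctan_ubound[of R] zero_less_arctan_iff[of R] by (intro power_mono divide_right_mono) auto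
  finally show ?thesis by (simp add: power_divide)
qed

text \<open>The averages \<open>A x r\<close> of \<open>V\<close> against the rescaled bump satisfy
  \<open>\<partial>\<^sub>r A x r = r \<integral> \<Delta>V (x + r y) bump2 y dy\<close>: they increase in \<open>r\<close>, and \<open>A 0\<close> grows only
  logarithmically, while \<open>A x \<bar>x\<bar>\<close> is controlled by \<open>A 0 (4 \<bar>x\<bar>)\<close>.\<close>

lemma subharmonic_log_growth:
  assumes c2: "c2fun V V1 V2 V11 V22"
    and Vnn: "\<And>z. 0 \<le> V z"
    and g0: "\<And>z. 0 \<le> V11 z + V22 z"
    and gC: "\<And>z. V11 z + V22 z \<le> C / ((1 + (Re z)\<^sup>2) * (1 + (Im z)\<^sup>2))"
  obtains K where "K > 0" "\<And>z. V z \<le> K + K * ln (1 + cmod z)"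
proof -
  have F: "\<And>z. (V has_derivative (\<lambda>h. V1 z * Re h + V2 z * Im h)) (at z)"
    and d1: "\<And>z. ((\<lambda>t. V1 (z + of_real t * 1)) has_real_derivative V11 z) (at 0)"
    and d2: "\<And>z. ((\<lambda>t. V2 (z + of_real t * \<i>)) has_real_derivative V22 z) (at 0)"
    and cV1: "continuous_on UNIV V1" and cV2: "continuous_on UNIV V2"
    and cV11: "continuous_on UNIV V11" and cV22: "continuous_on UNIV V22"
    using c2 by (auto simp: c2fun_def)
  have cV: "continuous_on UNIV V" using c2 by (rule c2fun_continuous)
  define P where "P = (\<lambda>x (r::real) (y::real\<times>real). x + of_real r * Complex (fst y) (snd y))"
  have cP: "continuous_on S (\<lambda>q. P x (f q) (h q))" if "continuous_on S f" "continuous_on S h"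
    for x and S :: "'x::topological_space set" and f h
    unfolding P_def Complex_eq by (intro continuous_intros that)
  have cc: "continuous_on S (\<lambda>q. G (P x (f q) (h q)))"
    if "continuous_on UNIV G" "continuous_on S f" "continuous_on S h"
    for x and S :: "'x::topological_space set" and f h and G :: "complex \<Rightarrow> real"
    by (rule continuous_on_compose2[OF that(1) cP[OF that(2,3)]]) auto
  define A where "A = (\<lambda>x r. integral Box (\<lambda>y. V (P x r y) * bump y))"
  have dA: "(A x has_real_derivative r * integral Box (\<lambda>y. (V11 (P x r y) + V22 (P x r y)) * bump2 y)) (at r)" for x r
  proof -
    have dV: "((\<lambda>r. V (P x r y) * bump y) has_real_derivative (V1 (P x r y) * fst y + V2 (P x r y) * snd y) * bump y) (at r within UNIV)" for r y
    proof -
      have "((\<lambda>t. V (x + of_real t * Complex (fst y) (snd y))) has_real_derivative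
         V1 (P x r y) * fst y + V2 (P x r y) * snd y) (at r)"
        unfolding P_def
        by (rule deriv_along_line[where G' = "\<lambda>z. V1 z * fst y + V2 z * snd y"])
           (use line_derivative[OF F, of _ "Complex (fst y) (snd y)"] in simp)
      from DERIV_cmult_right[OF this, of "bump y"] show ?thesis by (simp add: P_def)
    qed
    have 1: "(A x has_real_derivative integral Box (\<lambda>y. (V1 (P x r y) * fst y + V2 (P x r y) * snd y) * bump y)) (at r within UNIV)"
      unfolding A_def
      by (rule leibniz_rule_field_derivative[OF dV])
         (auto intro!: integrable_continuous continuous_intros cc cV cV1 cV2 simp: case_prod_beta)
    have shift: "P x r (0, t) + of_real (r * s) * 1 = P x r (s, t)"
      "P x r (s, 0) + of_real (r * t) * \<i> = P x r (s, t)" for s t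
      by (auto simp: P_def complex_eq_iff algebra_simps)
    \<comment> \<open>The integrand is the derivative of \<open>V1 (P x r y) * bump2 y\<close> in
      the first coordinate of \<open>y\<close>; the factor \<open>r\<close> comes from the chain
      rule. Adding \<open>b1\<close> and \<open>b2\<close> to the radial derivative leaves only the
      Laplacian.\<close>
    have b1: "integral Box (\<lambda>y. r * V11 (P x r y) * bump2 y + V1 (P x r y) * (- fst y * bump y)) = 0"
    proof (rule integral_partial_fst_0[where \<phi> = "\<lambda>y. V1 (P x r y) * bump2 y"])
      show "continuous_on UNIV (\<lambda>y. r * V11 (P x r y) * bump2 y + V1 (P x r y) * (- fst y * bump y))"
        unfolding bump2_def by (intro continuous_intros cc cV11 cV1) auto
      fix s t :: real
      have "((\<lambda>s. V1 (P x r (0, t) + of_real (r * s) * 1)) has_real_derivative V11 (P x r (0, t) + of_real (r * s) * 1) * r) (at s)"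
        by (rule DERIV_chain'[OF _ deriv_along_line[OF d1]]) (auto intro!: derivative_eq_intros)
      then have "((\<lambda>s. V1 (P x r (s, t))) has_real_derivative r * V11 (P x r (s, t))) (at s)"
        unfolding shift by (simp add: mult.commute)
      from DERIV_mult[OF this bump2_DERIV_fst]
      show "((\<lambda>s. V1 (P x r (s, t)) * bump2 (s, t)) has_real_derivative
        r * V11 (P x r (s, t)) * bump2 (s, t) + V1 (P x r (s, t)) * (- fst (s, t) * bump (s, t))) (at s)"
        by (simp add: algebra_simps)
    qed (simp_all add: bump2_edge)
    have b2: "integral Box (\<lambda>y. r * V22 (P x r y) * bump2 y + V2 (P x r y) * (- snd y * bump y)) = 0"
    proof (rule integral_partial_snd_0[where \<phi> = "\<lambda>y. V2 (P x r y) * bump2 y"])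
      show "continuous_on UNIV (\<lambda>y. r * V22 (P x r y) * bump2 y + V2 (P x r y) * (- snd y * bump y))"
        unfolding bump2_def by (intro continuous_intros cc cV22 cV2) auto
      fix s t :: real
      have "((\<lambda>t. V2 (P x r (s, 0) + of_real (r * t) * \<i>)) has_real_derivative V22 (P x r (s, 0) + of_real (r * t) * \<i>) * r) (at t)"
        by (rule DERIV_chain'[OF _ deriv_along_line[OF d2]]) (auto intro!: derivative_eq_intros)
      then have "((\<lambda>t. V2 (P x r (s, t))) has_real_derivative r * V22 (P x r (s, t))) (at t)"
        unfolding shift by (simp add: mult.commute)
      from DERIV_mult[OF this bump2_DERIV_snd]
      show "((\<lambda>t. V2 (P x r (s, t)) * bump2 (s, t)) has_real_derivative
        r * V22 (P x r (s, t)) * bump2 (s, t) + V2 (P x r (s, t)) * (- snd (s, t) * bump (s, t))) (at t)"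
        by (simp add: algebra_simps)
    qed (simp_all add: bump2_edge)
    have I1: "(\<lambda>y. (V1 (P x r y) * fst y + V2 (P x r y) * snd y) * bump y) integrable_on Box"
      and I2: "(\<lambda>y. r * V11 (P x r y) * bump2 y + V1 (P x r y) * (- fst y * bump y)) integrable_on Box"
      and I3: "(\<lambda>y. r * V22 (P x r y) * bump2 y + V2 (P x r y) * (- snd y * bump y)) integrable_on Box"
      unfolding bump2_def
      by (intro integrable_continuous continuous_intros cc cV11 cV22 cV1 cV2; simp)+
    have "integral Box (\<lambda>y. (V1 (P x r y) * fst y + V2 (P x r y) * snd y) * bump y)
      + (integral Box (\<lambda>y. r * V11 (P x r y) * bump2 y + V1 (P x r y) * (- fst y * bump y))
      + integral Box (\<lambda>y. r * V22 (P x r y) * bump2 y + V2 (P x r y) * (- snd y * bump y)))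
      = integral Box (\<lambda>y. (V1 (P x r y) * fst y + V2 (P x r y) * snd y) * bump y
      + (r * V11 (P x r y) * bump2 y + V1 (P x r y) * (- fst y * bump y)
      + (r * V22 (P x r y) * bump2 y + V2 (P x r y) * (- snd y * bump y))))"
      using integral_add[OF I1 integrable_add[OF I2 I3]] integral_add[OF I2 I3] by (simp only:)
    also have "\<dots> = integral Box (\<lambda>y. r * ((V11 (P x r y) + V22 (P x r y)) * bump2 y))"
      by (rule arg_cong[where f = "integral Box"]) (auto simp: algebra_simps)
    also have "\<dots> = r * integral Box (\<lambda>y. (V11 (P x r y) + V22 (P x r y)) * bump2 y)"
      by (rule integral_mult_right)
    finally show ?thesis using 1 b1 b2 by simp
  qed
  have gint: "(\<lambda>y. (V11 (P x r y) + V22 (P x r y)) * bump2 y) integrable_on Box" for x r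
    unfolding bump2_def by (intro integrable_continuous continuous_intros cc cV11 cV22) auto
  have mono: "A x 0 \<le> A x r" if "r \<ge> 0" for x r
  proof (rule DERIV_nonneg_imp_nondecreasing[OF that])
    fix s assume "0 \<le> s" "s \<le> r"
    then have "0 \<le> s * integral Box (\<lambda>y. (V11 (P x s y) + V22 (P x s y)) * bump2 y)"
      using g0 bump2_nonneg gint by (auto intro!: mult_nonneg_nonneg integral_nonneg)
    with dA[of x s] show "\<exists>y. (A x has_real_derivative y) (at s) \<and> 0 \<le> y" by blast
  qed
  define c0 where "c0 = integral Box bump"
  have c0: "c0 > 0" unfolding c0_def by (rule bump_integral_pos)
  have A0: "A x 0 = V x * c0" for x unfolding A_def P_def c0_def by simp
  have Cnn: "C \<ge> 0"
    using g0[of 0] gC[of 0] by simp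
  \<comment> \<open>By the decay hypothesis the integral is at most
    \<open>C * pi\<^sup>2 / r\<^sup>2\<close>, so the derivative of \<open>A 0\<close> is at most a
    multiple of \<open>1 / r\<close>, the derivative of a logarithm.\<close>
  have dA0: "r * integral Box (\<lambda>y. (V11 (P 0 r y) + V22 (P 0 r y)) * bump2 y) \<le> C * pi\<^sup>2 / r" if "r > 0" for r
  proof -
    have nz: "1 + (r * s)\<^sup>2 \<noteq> 0" for s by (metis add_pos_nonneg less_numeral_extra(1) less_numeral_extra(3) zero_le_power2)
    have "integral Box (\<lambda>y. (V11 (P 0 r y) + V22 (P 0 r y)) * bump2 y)
      \<le> integral Box (\<lambda>y. C * (1 / ((1 + (r * fst y)\<^sup>2) * (1 + (r * snd y)\<^sup>2))))"
    proof (rule integral_le[OF gint])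
      show "(\<lambda>y. C * (1 / ((1 + (r * fst y)\<^sup>2) * (1 + (r * snd y)\<^sup>2)))) integrable_on Box"
        by (intro integrable_continuous continuous_intros) (auto simp: nz)
      fix y
      have "(V11 (P 0 r y) + V22 (P 0 r y)) * bump2 y \<le> (V11 (P 0 r y) + V22 (P 0 r y)) * 1"
        using g0 bump2_le_1 by (intro mult_left_mono)
      also have "\<dots> \<le> C * (1 / ((1 + (r * fst y)\<^sup>2) * (1 + (r * snd y)\<^sup>2)))"
        using gC[of "P 0 r y"] by (simp add: P_def)
      finally show "(V11 (P 0 r y) + V22 (P 0 r y)) * bump2 y \<le> \<dots>" .
    qed
    also have "\<dots> \<le> C * (pi\<^sup>2 / r\<^sup>2)"
      unfolding integral_mult_right by (intro mult_left_mono Cnn arctan_box_integral that)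
    finally have "r * integral Box (\<lambda>y. (V11 (P 0 r y) + V22 (P 0 r y)) * bump2 y) \<le> r * (C * (pi\<^sup>2 / r\<^sup>2))"
      using that by (intro mult_left_mono) auto
    then show ?thesis using that by (simp add: power2_eq_square)
  qed
  have growth: "A 0 R \<le> A 0 1 + C * pi\<^sup>2 * ln R" if "R \<ge> 1" for R
  proof -
    have "A 0 R - C * pi\<^sup>2 * ln R \<le> A 0 1 - C * pi\<^sup>2 * ln 1"
    proof (rule DERIV_nonpos_imp_nonincreasing[OF that])
      fix r :: real assume r: "1 \<le> r" "r \<le> R"
      have "((\<lambda>r. A 0 r - C * pi\<^sup>2 * ln r) has_real_derivative
        r * integral Box (\<lambda>y. (V11 (P 0 r y) + V22 (P 0 r y)) * bump2 y) - C * pi\<^sup>2 / r) (at r)"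
        using r by (auto intro!: derivative_eq_intros dA)
      moreover have "r * integral Box (\<lambda>y. (V11 (P 0 r y) + V22 (P 0 r y)) * bump2 y) - C * pi\<^sup>2 / r \<le> 0"
        using dA0[of r] r by simp
      ultimately show "\<exists>y. ((\<lambda>r. A 0 r - C * pi\<^sup>2 * ln r) has_real_derivative y) (at r) \<and> y \<le> 0"
        by blast
    qed
    then show ?thesis by simp
  qed
  \<comment> \<open>The disc of radius \<open>cmod x\<close> about \<open>x\<close> lies in the disc
    of radius \<open>2 * cmod x\<close> about 0, on which the bump rescaled to radius
    \<open>4 * cmod x\<close> is at least 3/4. The constant is 16, from the scaling of area, times
    4/3.\<close>
  have compare: "A x (cmod x) \<le> 64 / 3 * A 0 (4 * cmod x)" if "x \<noteq> 0" for x
  proof -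
    define r where "r = cmod x"
    have r: "r > 0" using that by (simp add: r_def)
    define X where "X = (Re x, Im x)"
    have nX: "norm X = r" by (simp add: X_def norm_Pair r_def cmod_def)
    define a where "a = (Re x / (4 * r) - 1/4, Im x / (4 * r) - 1/4)"
    define b where "b = (Re x / (4 * r) + 1/4, Im x / (4 * r) + 1/4)"
    define c where "c = (Re x / (4 * r), Im x / (4 * r))"
    define H where "H = (\<lambda>z. V (P 0 (4 * r) z) * bump (4 *\<^sub>R z - X /\<^sub>R r))"
    have Hint: "H integrable_on cbox a b" unfolding H_def
      by (intro integrable_continuous continuous_intros cc cV)
    have "((\<lambda>y. H ((1/4) *\<^sub>R y + c)) has_integral (integral (cbox a b) H /\<^sub>R (1/4) ^ DIM(real \<times> real)))
        (cbox ((a - c) /\<^sub>R (1/4)) ((b - c) /\<^sub>R (1/4)))"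
      by (rule has_integral_affinity') (use Hint in auto)
    moreover have "(a - c) /\<^sub>R (1/4) = (-1, -1)" "(b - c) /\<^sub>R (1/4) = (1, 1)"
      by (auto simp: a_def b_def c_def scaleR_Pair)
    moreover have "H ((1/4) *\<^sub>R y + c) = V (P x r y) * bump y" for y
    proof -
      have "P 0 (4 * r) ((1/4) *\<^sub>R y + c) = P x r y"
        using r by (simp add: P_def c_def complex_eq_iff algebra_simps)
      moreover have "4 *\<^sub>R ((1/4) *\<^sub>R y + c) - X /\<^sub>R r = y"
        using r by (cases y) (simp add: c_def X_def scaleR_Pair field_simps)
      ultimately show ?thesis by (simp add: H_def)
    qed
    ultimately have AH: "A x r = 16 * integral (cbox a b) H"
      unfolding A_def by (simp add: integral_unique power2_eq_square field_simps)
    have int4: "(\<lambda>z. V (P 0 (4 * r) z) * bump z) integrable_on cbox a' b'" for a' b'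
      by (intro integrable_continuous continuous_intros cc cV)
    have "integral (cbox a b) H \<le> integral (cbox a b) (\<lambda>z. 4 / 3 * (V (P 0 (4 * r) z) * bump z))"
    proof (rule integral_le[OF Hint])
      show "(\<lambda>z. 4 / 3 * (V (P 0 (4 * r) z) * bump z)) integrable_on cbox a b"
        using int4 by (rule integrable_on_mult_right)
      fix z
      have "bump (4 *\<^sub>R z - X /\<^sub>R r) \<le> 4 / 3 * bump z"
      proof (cases "norm (4 *\<^sub>R z - X /\<^sub>R r) \<le> 1")
        case True
        have "norm (X /\<^sub>R r) = 1" using nX r by simp
        then have "norm (4 *\<^sub>R z) \<le> 2" using True norm_triangle_sub[of "4 *\<^sub>R z" "X /\<^sub>R r"] by linarith
        then have "norm z \<le> 1/2" by simp
        then have "(norm z)\<^sup>2 \<le> (1/2)\<^sup>2" by (intro power_mono) auto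
        then have "bump z \<ge> 3/4" by (simp add: bump_def power2_eq_square)
        then show ?thesis using bump_le_1[of "4 *\<^sub>R z - X /\<^sub>R r"] by linarith
      next
        case False
        then have "bump (4 *\<^sub>R z - X /\<^sub>R r) = 0"
          using one_le_power[of "norm (4 *\<^sub>R z - X /\<^sub>R r)" 2] by (simp add: bump_def)
        then show ?thesis using bump_nonneg[of z] by simp
      qed
      from mult_left_mono[OF this Vnn[of "P 0 (4 * r) z"]]
      show "H z \<le> 4 / 3 * (V (P 0 (4 * r) z) * bump z)" by (simp add: H_def mult_ac)
    qed
    also have "\<dots> = 4 / 3 * integral (cbox a b) (\<lambda>z. V (P 0 (4 * r) z) * bump z)"
      by (rule integral_mult_right)
    also have "integral (cbox a b) (\<lambda>z. V (P 0 (4 * r) z) * bump z) \<le> A 0 (4 * r)"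
      unfolding A_def
    proof (rule integral_subset_le[OF _ int4 int4])
      have "\<bar>Re x\<bar> \<le> r" "\<bar>Im x\<bar> \<le> r" by (auto simp: r_def abs_Re_le_cmod abs_Im_le_cmod)
      then have *: "- 1/4 \<le> Re x / (4 * r)" "Re x / (4 * r) \<le> 1/4" "- 1/4 \<le> Im x / (4 * r)" "Im x / (4 * r) \<le> 1/4"
        using r by (auto simp: field_simps abs_le_iff)
      show "cbox a b \<subseteq> Box"
        unfolding a_def b_def cbox_Pair_eq by (intro Sigma_mono) (use * in \<open>auto simp: algebra_simps\<close>)
    qed (use Vnn bump_nonneg in auto)
    finally show ?thesis using AH by (simp add: r_def)
  qed
  have "compact (cball (0::complex) 1)" by simp
  then obtain B where B: "\<And>z. z \<in> cball 0 1 \<Longrightarrow> norm (V z) \<le> B"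
    using compact_continuous_image[OF continuous_on_subset[OF cV subset_UNIV], of "cball 0 1"]
    by (meson bounded_iff compact_imp_bounded imageI)
  define k where "k = 64 / (3 * c0)"
  have k: "k > 0" using c0 by (simp add: k_def)
  \<comment> \<open>\<open>\<bar>B\<bar>\<close> serves the unit disc; the next two terms are the
    constant and the slope left after \<open>ln (4 * cmod z)\<close> is split.\<close>
  define K where "K = \<bar>B\<bar> + k * (\<bar>A 0 1\<bar> + C * pi\<^sup>2 * ln 4) + k * (C * pi\<^sup>2) + 1"
  have l4: "ln (4::real) > 0" by simp
  have nn: "0 \<le> k * (\<bar>A 0 1\<bar> + C * pi\<^sup>2 * ln 4)" "0 \<le> k * (C * pi\<^sup>2)"
    using k Cnn l4 by (auto intro!: mult_nonneg_nonneg add_nonneg_nonneg)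
  have K: "K > 0" using nn by (simp add: K_def)
  moreover have "V z \<le> K + K * ln (1 + cmod z)" for z
  proof (cases "cmod z \<le> 1")
    case True
    then have "V z \<le> B" using B[of z] by auto
    then have "V z \<le> K" using nn by (simp add: K_def)
    moreover have "K * ln (1 + cmod z) \<ge> 0" using K by simp
    ultimately show ?thesis by linarith
  next
    case False
    then have nz: "z \<noteq> 0" "cmod z > 1" by auto
    have "V z * c0 \<le> 64 / 3 * A 0 (4 * cmod z)"
      using mono[of "cmod z" z] compare[OF nz(1)] A0[of z] by simp
    also have "\<dots> \<le> 64 / 3 * (A 0 1 + C * pi\<^sup>2 * ln (4 * cmod z))"
      using growth[of "4 * cmod z"] nz by simp
    finally have "V z \<le> k * (A 0 1 + C * pi\<^sup>2 * ln (4 * cmod z))"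
      using c0 by (simp add: k_def field_simps)
    also have "ln (4 * cmod z) = ln 4 + ln (cmod z)" using nz by (simp add: ln_mult)
    also have "k * (A 0 1 + C * pi\<^sup>2 * (ln 4 + ln (cmod z))) =
        k * (A 0 1 + C * pi\<^sup>2 * ln 4) + k * (C * pi\<^sup>2) * ln (cmod z)" by (simp add: algebra_simps)
    also have "\<dots> \<le> K + K * ln (1 + cmod z)"
    proof (rule add_mono)
      have "k * (A 0 1 + C * pi\<^sup>2 * ln 4) \<le> k * (\<bar>A 0 1\<bar> + C * pi\<^sup>2 * ln 4)"
        using k by (intro mult_left_mono) auto
      then show "k * (A 0 1 + C * pi\<^sup>2 * ln 4) \<le> K" using nn by (simp add: K_def)
      have "k * (C * pi\<^sup>2) \<le> K" using nn by (simp add: K_def)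
      moreover have "0 \<le> ln (cmod z)" "ln (cmod z) \<le> ln (1 + cmod z)" using nz by auto
      ultimately show "k * (C * pi\<^sup>2) * ln (cmod z) \<le> K * ln (1 + cmod z)"
        using K by (intro mult_mono) auto
    qed
    finally show ?thesis .
  qed
  ultimately show ?thesis using that by blast
qed

section \<open>Coercivity and decay\<close>

lemma powr_diff_le:
  fixes a b q :: real
  assumes "0 < a" "a \<le> b" "1 \<le> q"
  shows "b powr q - a powr q \<le> q * b powr (q - 1) * (b - a)"
proof (cases "a = b")
  case False
  have "\<exists>z. a < z \<and> z < b \<and> b powr q - a powr q = (b - a) * (q * z powr (q - 1))"
    by (rule MVT2) (use assms False in \<open>auto intro!: derivative_eq_intros simp: powr_diff field_simps\<close>)
  then obtain z where z: "a < z" "z < b" "b powr q - a powr q = (b - a) * (q * z powr (q - 1))" by blast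
  have "z powr (q - 1) \<le> b powr (q - 1)" using z assms by (intro powr_mono2) auto
  then have "(b - a) * (q * z powr (q - 1)) \<le> (b - a) * (q * b powr (q - 1))"
    using assms by (intro mult_left_mono) auto
  then show ?thesis using z by (simp add: mult_ac)
qed simp

text \<open>In \<open>a powr q = a * a powr (q - 1)\<close> the second factor is enlarged to
  \<open>b powr (q - 1)\<close>. With \<open>q = p - 1\<close> this extracts the factor
  \<open>u z powr (p - 2)\<close> behind coercivity.\<close>

lemma powr_diff_ge:
  fixes a b q :: real
  assumes "0 < a" "a \<le> b" "1 \<le> q"
  shows "(b - a) * b powr (q - 1) \<le> b powr q - a powr q"
proof -
  have e: "x powr q = x * x powr (q - 1)" if "x > 0" for x :: real
    using that powr_mult_base[of x "q - 1"] by simp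
  have "a * a powr (q - 1) \<le> a * b powr (q - 1)" using assms by (intro mult_left_mono powr_mono2) auto
  then show ?thesis using assms by (simp add: e algebra_simps)
qed

lemma locally_lipschitz_on_compact:
  assumes "locally_lipschitz f" "compact X"
  obtains L where "L > 0" "\<And>a b. a \<in> X \<Longrightarrow> b \<in> X \<Longrightarrow> \<bar>f a - f b\<bar> \<le> L * \<bar>a - b\<bar>"
proof -
  \<comment> \<open>A one-point time set reduces the library notion for time-dependent functions to
    the present one.\<close>
  have "local_lipschitz {0::real} X (\<lambda>t. f)"
    unfolding local_lipschitz_def
  proof (intro ballI)
    fix x t assume "x \<in> X"
    obtain e L where "e > 0" "L-lipschitz_on (cball x e) f"
      using assms(1) unfolding locally_lipschitz_def by blast
    then show "\<exists>u>0. \<exists>L. \<forall>s\<in>cball t u \<inter> {0}. L-lipschitz_on (cball x u \<inter> X) f"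
      by (meson Int_lower1 lipschitz_on_subset)
  qed
  from local_lipschitz_compact_implies_lipschitz[OF this assms(2)]
  obtain L where L: "L-lipschitz_on X f" by force
  show ?thesis
  proof (rule that[of "L + 1"])
    show "L + 1 > 0" using lipschitz_on_nonneg[OF L] by simp
    fix a b assume "a \<in> X" "b \<in> X"
    then have "\<bar>f a - f b\<bar> \<le> L * \<bar>a - b\<bar>" using lipschitz_onD[OF L] by (simp add: dist_real_def)
    also have "\<dots> \<le> (L + 1) * \<bar>a - b\<bar>" by (intro mult_right_mono) auto
    finally show "\<bar>f a - f b\<bar> \<le> (L + 1) * \<bar>a - b\<bar>" .
  qed
qed

lemma filterlim_exp_linear:
  fixes e b n :: real
  assumes "e > 0" "b > 0"
  shows "filterlim (\<lambda>x. e * exp (b * x) - n) at_top at_top"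
  using assms by real_asymp

lemma exp_exceeds_one:
  fixes e b :: real
  assumes "e > 0" "b > 0"
  obtains K where "\<And>r. K \<le> r \<Longrightarrow> 1 < e * exp (b * r)"
proof -
  have "\<forall>\<^sub>F r in at_top. 1 < e * exp (b * r)" using assms by real_asymp
  then show ?thesis using that unfolding eventually_at_top_linorder by blast
qed

text \<open>The system in coordinates where the lines of reflection are vertical; it is interpreted
  once for each unit vector, after a rotation. Positivity of \<open>u\<close> has already removed
  the absolute values from the powers.\<close>

locale choquard =
  fixes p \<gamma> :: real and f :: "real \<Rightarrow> real" and u u1 u2 u11 u22 w w1 w2 w11 w22 :: "complex \<Rightarrow> real"
  assumes p: "2 \<le> p" and \<gamma>: "0 < \<gamma>"
    and flip: "locally_lipschitz f" and f0: "f 0 = 0"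
    and fdec: "p > 2 \<Longrightarrow> (\<exists>\<epsilon>0>0. \<exists>a0>0. \<forall>x y. 0 < x \<and> x < \<epsilon>0 \<and> 0 < y \<and> y < \<epsilon>0 \<and> x \<noteq> y
            \<longrightarrow> (f x - f y) / (x - y) \<le> - a0)"
    and cu: "c2fun u u1 u2 u11 u22" and cw: "c2fun w w1 w2 w11 w22"
    and equ: "u11 z + u22 z = - (\<gamma> * w z * u z powr (p - 1) + f (u z))"
    and eqw: "w11 z + w22 z = - (u z powr p)"
    and upos: "u z > 0" and ubd: "bounded (range u)"
    and wlim: "filterlim w at_bot at_infinity"
begin

definition N where "N = Sup (range u)"

lemma u_le: "u z \<le> N"
  unfolding N_def by (rule cSUP_upper) (use ubd in \<open>auto simp: bounded_imp_bdd_above\<close>)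

lemma N_pos: "N > 0" using upos u_le less_le_trans by blast

lemma lap_u: "has_lap u z (- (\<gamma> * w z * u z powr (p - 1) + f (u z)))"
  using c2fun_has_lap[OF cu] equ by metis

lemma lap_w: "has_lap w z (- (u z powr p))"
  using c2fun_has_lap[OF cw] eqw by metis

lemma cont_u: "continuous_on S u" and cont_w: "continuous_on S w"
  using cu cw c2fun_continuous by blast+

lemma f_lipschitz:
  obtains L where "L > 0" "\<And>a b. 0 \<le> a \<Longrightarrow> a \<le> N \<Longrightarrow> 0 \<le> b \<Longrightarrow> b \<le> N \<Longrightarrow> \<bar>f a - f b\<bar> \<le> L * \<bar>a - b\<bar>"
  using locally_lipschitz_on_compact[OF flip compact_Icc[of 0 N]] by (metis atLeastAtMost_iff)

lemma w_small:
  obtains R where "R \<ge> 0" "\<And>z. R \<le> cmod z \<Longrightarrow> w z \<le> c"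
proof -
  from wlim have "\<forall>\<^sub>F z in at_infinity. w z \<le> c" by (simp add: filterlim_at_bot)
  then obtain b where "\<And>z. b \<le> cmod z \<Longrightarrow> w z \<le> c" unfolding eventually_at_infinity by blast
  then show ?thesis using that[of "max b 0"] by simp
qed

lemma w_bounded_above:
  obtains M where "M \<ge> 0" "\<And>z. w z \<le> M"
proof -
  obtain R where R: "R \<ge> 0" "\<And>z. R \<le> cmod z \<Longrightarrow> w z \<le> 0" by (rule w_small) blast
  have "compact (cball (0::complex) R)" "cball (0::complex) R \<noteq> {}" using R by auto
  then obtain q where q: "\<And>z. z \<in> cball 0 R \<Longrightarrow> w z \<le> w q"
    using continuous_attains_sup[of "cball 0 R" w] cont_w by blast
  have "w z \<le> max 0 (w q)" for z
    using R(2)[of z] q[of z] by (cases "R \<le> cmod z") (auto simp: le_max_iff_disj)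
  then show ?thesis using that[of "max 0 (w q)"] by simp
qed

text \<open>Where \<open>w\<close> is very negative, the nonlinearity is coercive: for \<open>p = 2\<close> because of the factor \<open>w\<close> alone,
  for \<open>p > 2\<close> this degenerates as \<open>u \<rightarrow> 0\<close>, and the hypothesis on \<open>f\<close> near \<open>0\<close> takes over.\<close>

lemma coercive:
  obtains a R where "a > 0" "R \<ge> 0" "\<And>z. R \<le> cmod z \<Longrightarrow> w z \<le> 0"
    "\<And>z b. R \<le> cmod z \<Longrightarrow> 0 < b \<Longrightarrow> b < u z \<Longrightarrow>
      a * (u z - b) \<le> \<gamma> * w z * (b powr (p - 1) - u z powr (p - 1)) + f b - f (u z)"
proof -
  obtain L where L: "L > 0" "\<And>a b. 0 \<le> a \<Longrightarrow> a \<le> N \<Longrightarrow> 0 \<le> b \<Longrightarrow> b \<le> N \<Longrightarrow> \<bar>f a - f b\<bar> \<le> L * \<bar>a - b\<bar>"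
    by (rule f_lipschitz) blast
  have Lb: "- L * (u z - b) \<le> f b - f (u z)" if "0 < b" "b < u z" for z b
    using L(2)[of b "u z"] that u_le[of z] by (simp add: abs_le_iff)
  \<comment> \<open>The lower bound \<open>e\<close> for \<open>u z powr (p - 2)\<close> is a
    parameter: it is 1 for \<open>p = 2\<close>, and \<open>\<epsilon>0 powr (p - 2)\<close> for
    \<open>p > 2\<close> at points where \<open>u z \<ge> \<epsilon>0\<close>. The threshold for
    \<open>w z\<close> makes the power term outweigh the Lipschitz constant of \<open>f\<close> by
    1.\<close>
  have main: "1 * (u z - b) \<le> \<gamma> * w z * (b powr (p - 1) - u z powr (p - 1)) + f b - f (u z)"
    if b: "0 < b" "b < u z" and e: "e > 0" "e \<le> u z powr (p - 2)" and w: "w z \<le> - (L + 1) / (\<gamma> * e)" for z b e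
  proof -
    have "(u z - b) * e \<le> (u z - b) * u z powr (p - 2)" using b e by (intro mult_left_mono) auto
    also have "\<dots> \<le> u z powr (p - 1) - b powr (p - 1)"
      using powr_diff_ge[of b "u z" "p - 1"] b p by simp
    finally have 1: "(u z - b) * e \<le> u z powr (p - 1) - b powr (p - 1)" .
    have 2: "L + 1 \<le> (- \<gamma> * w z) * e" using w e \<gamma> by (simp add: field_simps)
    have "(L + 1) / e \<le> - \<gamma> * w z" using 2 e by (simp add: field_simps)
    moreover have "0 < (L + 1) / e" using L e by simp
    ultimately have "0 \<le> - \<gamma> * w z" by linarith
    from mult_left_mono[OF 1 this]
    have "(- \<gamma> * w z) * ((u z - b) * e) \<le> (- \<gamma> * w z) * (u z powr (p - 1) - b powr (p - 1))" .
    moreover have "(L + 1) * (u z - b) \<le> ((- \<gamma> * w z) * e) * (u z - b)"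
      using 2 b by (intro mult_right_mono) auto
    ultimately show ?thesis using Lb[OF b] by (simp add: algebra_simps)
  qed
  show ?thesis
  proof (cases "p = 2")
    case True
    obtain R where R: "R \<ge> 0" "\<And>z. R \<le> cmod z \<Longrightarrow> w z \<le> - (L + 1) / (\<gamma> * 1)" by (rule w_small) blast
    have "- (L + 1) / (\<gamma> * 1) \<le> 0" by (rule divide_nonpos_pos) (use L \<gamma> in auto)
    then have "w z \<le> 0" if "R \<le> cmod z" for z using R(2)[OF that] by linarith
    moreover have "1 * (u z - b) \<le> \<gamma> * w z * (b powr (p - 1) - u z powr (p - 1)) + f b - f (u z)"
      if "R \<le> cmod z" "0 < b" "b < u z" for z b
      by (rule main[of b z 1]) (use that R upos[of z] True in auto)
    ultimately show ?thesis using that[of 1 R] R by simp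
  next
    case False
    then obtain \<epsilon>0 a0 where ea: "\<epsilon>0 > 0" "a0 > 0"
      and fd: "\<And>x y. 0 < x \<Longrightarrow> x < \<epsilon>0 \<Longrightarrow> 0 < y \<Longrightarrow> y < \<epsilon>0 \<Longrightarrow> x \<noteq> y \<Longrightarrow> (f x - f y) / (x - y) \<le> - a0"
      using fdec p by (metis less_eq_real_def)
    obtain R where R: "R \<ge> 0" "\<And>z. R \<le> cmod z \<Longrightarrow> w z \<le> - (L + 1) / (\<gamma> * \<epsilon>0 powr (p - 2))" by (rule w_small) blast
    have "- (L + 1) / (\<gamma> * \<epsilon>0 powr (p - 2)) \<le> 0"
      by (rule divide_nonpos_pos) (use L \<gamma> ea in auto)
    then have w0: "w z \<le> 0" if "R \<le> cmod z" for z using R(2)[OF that] by linarith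
    have "min 1 a0 * (u z - b) \<le> \<gamma> * w z * (b powr (p - 1) - u z powr (p - 1)) + f b - f (u z)"
      if z: "R \<le> cmod z" and b: "0 < b" "b < u z" for z b
    proof (cases "u z < \<epsilon>0")
      case True
      have "(f (u z) - f b) / (u z - b) \<le> - a0" by (rule fd) (use b True in auto)
      then have "a0 * (u z - b) \<le> f b - f (u z)" using b by (simp add: field_simps)
      moreover have "min 1 a0 * (u z - b) \<le> a0 * (u z - b)" using b by (intro mult_right_mono) auto
      moreover have "b powr (p - 1) \<le> u z powr (p - 1)" using b p by (intro powr_mono2) auto
      then have "0 \<le> \<gamma> * w z * (b powr (p - 1) - u z powr (p - 1))"
        using w0[OF z] \<gamma> by (intro mult_nonpos_nonpos) (auto simp: mult_nonneg_nonpos)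
      ultimately show ?thesis by linarith
    next
      case False
      have "1 * (u z - b) \<le> \<gamma> * w z * (b powr (p - 1) - u z powr (p - 1)) + f b - f (u z)"
        by (rule main[of b z "\<epsilon>0 powr (p - 2)"]) (use False b R z ea p in \<open>auto intro!: powr_mono2\<close>)
      moreover have "min 1 a0 * (u z - b) \<le> 1 * (u z - b)" using b by (intro mult_right_mono) auto
      ultimately show ?thesis by linarith
    qed
    then show ?thesis using that[of "min 1 a0" R] ea R w0 by auto
  qed
qed

text \<open>This is the limit of \<open>coercive\<close> as \<open>b\<close> tends to 0: there
  \<open>f b \<le> L * b\<close> because \<open>f 0 = 0\<close>, and the term with
  \<open>b powr (p - 1)\<close> is nonpositive because \<open>w z\<close> is.\<close>

lemma lap_u_lower:
  obtains a R where "a > 0" "R \<ge> 0"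
    "\<And>z. R \<le> cmod z \<Longrightarrow> a * u z \<le> - (\<gamma> * w z * u z powr (p - 1) + f (u z))"
proof -
  obtain L where L: "L > 0" "\<And>a b. 0 \<le> a \<Longrightarrow> a \<le> N \<Longrightarrow> 0 \<le> b \<Longrightarrow> b \<le> N \<Longrightarrow> \<bar>f a - f b\<bar> \<le> L * \<bar>a - b\<bar>"
    by (rule f_lipschitz) blast
  obtain a R where a: "a > 0" "R \<ge> 0" and w0: "\<And>z. R \<le> cmod z \<Longrightarrow> w z \<le> 0"
    and co: "\<And>z b. R \<le> cmod z \<Longrightarrow> 0 < b \<Longrightarrow> b < u z \<Longrightarrow>
      a * (u z - b) \<le> \<gamma> * w z * (b powr (p - 1) - u z powr (p - 1)) + f b - f (u z)"
    by (rule coercive) blast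
  have "a * u z \<le> - (\<gamma> * w z * u z powr (p - 1) + f (u z))" if z: "R \<le> cmod z" for z
  proof (rule field_le_epsilon)
    fix e :: real assume e: "e > 0"
    define b where "b = min (u z / 2) (e / (L + a))"
    have b: "0 < b" "b < u z" using upos[of z] e L a by (auto simp: b_def)
    have "b \<le> e / (L + a)" by (simp add: b_def)
    then have b3: "b * (L + a) \<le> e" using L a by (simp add: pos_le_divide_eq)
    have "a * (u z - b) \<le> \<gamma> * w z * (b powr (p - 1) - u z powr (p - 1)) + f b - f (u z)"
      by (rule co[OF z b(1,2)])
    moreover have "f b \<le> L * b" using L(2)[of b 0] b f0 u_le[of z] N_pos by simp
    moreover have "\<gamma> * w z * b powr (p - 1) \<le> 0"
      using w0[OF z] \<gamma> by (simp add: mult_nonneg_nonpos mult_nonneg_nonpos2)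
    ultimately show "a * u z \<le> - (\<gamma> * w z * u z powr (p - 1) + f (u z)) + e"
      using b3 by (simp add: algebra_simps)
  qed
  then show ?thesis using that a by blast
qed

text \<open>For each \<open>z0\<close> the barrier is a plane wave \<open>e\<close> decaying in the
  direction of \<open>z0\<close>, so that its value at \<open>z0\<close> is exactly the radial
  bound. A small multiple of \<open>E\<close>, which grows in all directions, makes the minimum of
  the difference exist and is then sent to 0. Both have Laplacian \<open>\<beta>\<^sup>2\<close>
  times themselves, matching the lower bound for the Laplacian of \<open>u\<close>.\<close>

lemma u_decay:
  obtains C \<beta> where "C > 0" "\<beta> > 0" "\<And>z. u z \<le> C * exp (- \<beta> * cmod z)"
proof -
  obtain a R where a: "a > 0" "R \<ge> 0"
    and lo: "\<And>z. R \<le> cmod z \<Longrightarrow> a * u z \<le> - (\<gamma> * w z * u z powr (p - 1) + f (u z))"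
    by (rule lap_u_lower) blast
  define \<beta> where "\<beta> = sqrt a"
  have \<beta>: "\<beta> > 0" "\<beta>\<^sup>2 = a" using a by (auto simp: \<beta>_def)
  \<comment> \<open>Lifts \<open>C * e\<close> to at least \<open>N\<close> on the disc of radius
    \<open>R\<close>, where \<open>lo\<close> gives no information.\<close>
  define C where "C = N * exp (\<beta> * R)"
  have C: "C > 0" using N_pos by (simp add: C_def)
  have CN: "C \<ge> N" using N_pos \<beta> a by (simp add: C_def)
  have "u z0 \<le> C * exp (- \<beta> * cmod z0)" for z0
  proof (cases "z0 = 0")
    case True then show ?thesis using u_le[of 0] CN by simp
  next
    case False
    define dx dy where "dx = Re z0 / cmod z0" and "dy = Im z0 / cmod z0"
    have d1: "dx\<^sup>2 + dy\<^sup>2 = 1"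
      using False by (simp add: dx_def dy_def power_divide add_divide_distrib[symmetric] cmod_power2[symmetric])
    define e where "e = (\<lambda>z. exp ((- \<beta> * dx) * Re z + (- \<beta> * dy) * Im z))"
    have e_lap: "has_lap e z (\<beta>\<^sup>2 * e z)" for z
      using has_lap_exp_linear[of "- \<beta> * dx" "- \<beta> * dy" z] d1
      by (simp add: e_def power_mult_distrib distrib_left[symmetric])
    have e_z0: "e z0 = exp (- \<beta> * cmod z0)"
    proof -
      have "dx * Re z0 + dy * Im z0 = cmod z0"
        using False cmod_power2[of z0] by (simp add: dx_def dy_def field_simps power2_eq_square)
      then show ?thesis unfolding e_def by (metis (no_types, opaque_lifting) distrib_left mult.assoc)
    qed
    \<comment> \<open>One of \<open>\<bar>Re z\<bar>\<close> and \<open>\<bar>Im z\<bar>\<close> is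
      at least half of \<open>cmod z\<close>, so one of the four summands is at least
      \<open>exp (\<beta> / 2 * cmod z)\<close>.\<close>
    define E where "E = (\<lambda>z. (exp (\<beta> * Re z + 0 * Im z) + exp (- \<beta> * Re z + 0 * Im z)) + (exp (0 * Re z + \<beta> * Im z) + exp (0 * Re z + - \<beta> * Im z)))"
    have E_lap: "has_lap E z (\<beta>\<^sup>2 * E z)" for z
    proof -
      have "has_lap E z (((\<beta>\<^sup>2 + 0\<^sup>2) * exp (\<beta> * Re z + 0 * Im z) + ((- \<beta>)\<^sup>2 + 0\<^sup>2) * exp (- \<beta> * Re z + 0 * Im z)) +
         ((0\<^sup>2 + \<beta>\<^sup>2) * exp (0 * Re z + \<beta> * Im z) + (0\<^sup>2 + (- \<beta>)\<^sup>2) * exp (0 * Re z + - \<beta> * Im z)))"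
        unfolding E_def by (intro has_lap_add has_lap_exp_linear)
      then show ?thesis by (simp add: E_def algebra_simps)
    qed
    have E_pos: "E z > 0" for z by (simp add: E_def add_pos_pos)
    have E_big: "exp (\<beta> / 2 * cmod z) \<le> E z" for z
    proof -
      have "cmod z \<le> \<bar>Re z\<bar> + \<bar>Im z\<bar>" by (rule cmod_le)
      then consider "cmod z \<le> 2 * Re z" | "cmod z \<le> 2 * (- Re z)" | "cmod z \<le> 2 * Im z" | "cmod z \<le> 2 * (- Im z)"
        by linarith
      then have "\<exists>x\<in>{Re z, - Re z, Im z, - Im z}. cmod z / 2 \<le> x" by cases force+
      then obtain x where x: "x \<in> {Re z, - Re z, Im z, - Im z}" "cmod z / 2 \<le> x" by blast
      have "exp (\<beta> / 2 * cmod z) \<le> exp (\<beta> * x)"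
        using x(2) \<beta> mult_left_mono[of "cmod z / 2" x \<beta>] by simp
      also have "\<dots> \<le> E z"
      proof -
        note ps = exp_gt_zero[of "\<beta> * Re z"] exp_gt_zero[of "- (\<beta> * Re z)"] exp_gt_zero[of "\<beta> * Im z"] exp_gt_zero[of "- (\<beta> * Im z)"]
        show ?thesis using x(1) ps unfolding E_def by auto
      qed
      finally show ?thesis .
    qed
    have eps: "u z0 \<le> C * e z0 + \<epsilon> * E z0" if \<epsilon>: "\<epsilon> > 0" for \<epsilon>
    proof (rule ccontr)
      assume neg: "\<not> ?thesis"
      define G where "G = (\<lambda>z. C * e z + \<epsilon> * E z - u z)"
      have h: "filterlim (\<lambda>x. \<epsilon> * exp (\<beta> / 2 * x) - N) at_top at_top"
        using filterlim_exp_linear[OF \<epsilon>, of "\<beta> / 2"] \<beta>(1) by simp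
      have "\<epsilon> * exp (\<beta> / 2 * cmod z) - N \<le> G z" for z
      proof -
        have "\<epsilon> * exp (\<beta> / 2 * cmod z) \<le> \<epsilon> * E z" using \<epsilon> E_big by (intro mult_left_mono) auto
        moreover have "C * e z \<ge> 0" using C by (simp add: e_def)
        ultimately show ?thesis using u_le[of z] by (simp add: G_def)
      qed
      then obtain K where K: "\<And>z. z \<in> UNIV \<Longrightarrow> cmod z \<ge> K \<Longrightarrow> G z0 \<le> G z"
        using filterlim_norm_bound[OF h, of UNIV G "G z0"] by blast
      have cG: "continuous_on UNIV G" unfolding G_def e_def E_def by (intro continuous_intros cont_u)
      obtain z where z: "\<And>x. G z \<le> G x"
        by (rule attains_min_closed[OF closed_UNIV cG UNIV_I, of K z0]) (use K in auto)
      have Gneg: "G z < 0" using neg z[of z0] by (simp add: G_def)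
      have "R \<le> cmod z"
      proof (rule ccontr)
        assume "\<not> R \<le> cmod z"
        have "(dx * Re z + dy * Im z) \<le> cmod z"
        proof -
          have "(dx * Re z + dy * Im z)\<^sup>2 + (dx * Im z - dy * Re z)\<^sup>2 = (dx\<^sup>2 + dy\<^sup>2) * ((Re z)\<^sup>2 + (Im z)\<^sup>2)"
            by (simp add: power2_eq_square algebra_simps)
          then have "(dx * Re z + dy * Im z)\<^sup>2 \<le> (cmod z)\<^sup>2"
            using d1 cmod_power2[of z] by (metis mult_1 le_add_same_cancel1 zero_le_power2)
          then show ?thesis by (rule power2_le_imp_le) simp
        qed
        then have "\<beta> * (dx * Re z + dy * Im z) \<le> \<beta> * R"
          using \<open>\<not> R \<le> cmod z\<close> \<beta> by (intro mult_left_mono) auto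
        then have "exp (\<beta> * R) * e z \<ge> 1" unfolding e_def exp_add[symmetric] by (simp add: algebra_simps)
        then have "C * e z \<ge> N * 1" unfolding C_def mult.assoc using N_pos by (intro mult_left_mono) auto
        moreover have "\<epsilon> * E z > 0" using \<epsilon> E_pos by simp
        ultimately show False using u_le[of z] Gneg by (simp add: G_def)
      qed
      from lo[OF this] have 1: "\<beta>\<^sup>2 * u z \<le> - (\<gamma> * w z * u z powr (p - 1) + f (u z))" using \<beta> by simp
      have "has_lap G z (C * (\<beta>\<^sup>2 * e z) + \<epsilon> * (\<beta>\<^sup>2 * E z) - (- (\<gamma> * w z * u z powr (p - 1) + f (u z))))"
        unfolding G_def by (intro has_lap_diff has_lap_add has_lap_cmult lap_u e_lap E_lap)
      then have "0 \<le> C * (\<beta>\<^sup>2 * e z) + \<epsilon> * (\<beta>\<^sup>2 * E z) - (- (\<gamma> * w z * u z powr (p - 1) + f (u z)))"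
        by (rule has_lap_local_min) (use z in auto)
      with 1 have "0 \<le> \<beta>\<^sup>2 * G z" by (simp add: G_def algebra_simps)
      moreover have "\<beta>\<^sup>2 * G z < 0" using \<beta> Gneg by (intro mult_pos_neg) auto
      ultimately show False by simp
    qed
    have "u z0 \<le> C * e z0"
    proof (rule field_le_epsilon)
      fix \<delta> :: real assume "\<delta> > 0"
      then show "u z0 \<le> C * e z0 + \<delta>" using eps[of "\<delta> / E z0"] E_pos[of z0] by simp
    qed
    then show ?thesis by (simp add: e_z0)
  qed
  then show ?thesis using that C \<beta> by blast
qed

text \<open>\<open>subharmonic_log_growth\<close> applies to \<open>M - w\<close>: it is
  nonnegative, and its Laplacian \<open>u z powr p\<close> is dominated by the product weight
  because of the exponential decay.\<close>

lemma w_lower: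
  obtains K where "K > 0" "\<And>z. - K - K * ln (1 + cmod z) \<le> w z"
proof -
  obtain M where M: "M \<ge> 0" "\<And>z. w z \<le> M" by (rule w_bounded_above) blast
  obtain C \<beta> where C: "C > 0" "\<beta> > 0" and dec: "\<And>z. u z \<le> C * exp (- \<beta> * cmod z)" by (rule u_decay) blast
  \<comment> \<open>Ensures \<open>1 + t \<le> k * exp (\<beta> * t / 4)\<close> for
    \<open>t \<ge> 0\<close>; the fourth power of this bounds the product weight.\<close>
  define k where "k = max 1 (4 / \<beta>)"
  have k: "k \<ge> 1" "k * \<beta> \<ge> 4" using C by (auto simp: k_def field_simps max_def)
  have exp_bound: "(1 + (Re z)\<^sup>2) * (1 + (Im z)\<^sup>2) \<le> k ^ 4 * exp (\<beta> * cmod z)" for z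
  proof -
    let ?r = "cmod z"
    have sq: "1 + x\<^sup>2 \<le> (1 + ?r)\<^sup>2" if "\<bar>x\<bar> \<le> ?r" for x
    proof -
      have "x\<^sup>2 \<le> ?r\<^sup>2" using that by (metis abs_ge_zero power2_abs power_mono)
      then show ?thesis by (simp add: power2_sum add_increasing2)
    qed
    have "(1 + (Re z)\<^sup>2) * (1 + (Im z)\<^sup>2) \<le> (1 + ?r)\<^sup>2 * (1 + ?r)\<^sup>2"
      by (intro mult_mono sq abs_Re_le_cmod abs_Im_le_cmod) auto
    also have "\<dots> = (1 + ?r) ^ 4" by (simp add: power2_eq_square power4_eq_xxxx algebra_simps)
    also have "\<dots> \<le> (k * exp (\<beta> * ?r / 4)) ^ 4"
    proof (rule power_mono)
      have "1 + ?r \<le> k * (1 + \<beta> * ?r / 4)"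
        using k mult_right_mono[OF k(2), of ?r] by (simp add: algebra_simps)
      also have "\<dots> \<le> k * exp (\<beta> * ?r / 4)" using k exp_ge_add_one_self by (intro mult_left_mono) auto
      finally show "1 + ?r \<le> k * exp (\<beta> * ?r / 4)" .
    qed simp
    also have "\<dots> = k ^ 4 * exp (\<beta> * ?r)" by (simp add: power_mult_distrib exp_of_nat_mult[symmetric])
    finally show ?thesis .
  qed
  define B where "B = N powr (p - 1) * C * k ^ 4"
  have up: "u z powr p \<le> B / ((1 + (Re z)\<^sup>2) * (1 + (Im z)\<^sup>2))" for z
  proof -
    have pos: "0 < (1 + (Re z)\<^sup>2) * (1 + (Im z)\<^sup>2)" by (intro mult_pos_pos add_pos_nonneg) auto
    have "u z powr p = u z powr (p - 1) * u z"
      using powr_mult_base[of "u z" "p - 1"] upos[of z] by (simp add: mult.commute)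
    also have "\<dots> \<le> N powr (p - 1) * (C * exp (- \<beta> * cmod z))"
      using upos[of z] u_le[of z] p dec by (intro mult_mono powr_mono2) (auto simp: less_imp_le)
    finally have le: "u z powr p \<le> N powr (p - 1) * (C * exp (- \<beta> * cmod z))" .
    have "u z powr p * ((1 + (Re z)\<^sup>2) * (1 + (Im z)\<^sup>2)) \<le> N powr (p - 1) * (C * exp (- \<beta> * cmod z)) * (k ^ 4 * exp (\<beta> * cmod z))"
      by (rule mult_mono[OF le exp_bound]) (use C in auto)
    also have "\<dots> = B" by (simp add: B_def exp_minus field_simps)
    finally show ?thesis using pos by (simp add: field_simps)
  qed
  have c2: "c2fun (\<lambda>z. M - w z) (\<lambda>z. - w1 z) (\<lambda>z. - w2 z) (\<lambda>z. - w11 z) (\<lambda>z. - w22 z)"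
    by (rule c2fun_affine[OF cw])
  have e: "- w11 z + - w22 z = u z powr p" for z using eqw[of z] by simp
  obtain K where K: "K > 0" "\<And>z. M - w z \<le> K + K * ln (1 + cmod z)"
    by (rule subharmonic_log_growth[OF c2, of B]) (use M up e in auto)
  have "- K - K * ln (1 + cmod z) \<le> w z" for z using K(2)[of z] M by linarith
  then show ?thesis using that K by blast
qed

section \<open>Moving planes\<close>

definition U where "U l z = u (mirror l z) - u z"
definition W where "W l z = w (mirror l z) - w z"

lemma cont_U: "continuous_on S (U l)" and cont_W: "continuous_on S (W l)"
  unfolding U_def W_def
  by (intro continuous_intros cont_u cont_w continuous_on_compose2[OF cont_u[of UNIV] continuous_mirror]
      continuous_on_compose2[OF cont_w[of UNIV] continuous_mirror]; simp)+

lemma U_boundary: "Re z = l \<Longrightarrow> U l z = 0" and W_boundary: "Re z = l \<Longrightarrow> W l z = 0"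
proof -
  assume "Re z = l"
  then have "mirror l z = z" by (simp add: complex_eq_iff)
  then show "U l z = 0" "W l z = 0" by (simp_all add: U_def W_def)
qed

text \<open>The difference of the two products is split so that \<open>W\<close> appears with a
  positive coefficient, while the remaining bracket is the expression of \<open>coercive\<close>
  with \<open>b = u (mirror l z)\<close>.\<close>

lemma lap_U: "has_lap (U l) z (- (\<gamma> * W l z * u (mirror l z) powr (p - 1)
    + (\<gamma> * w z * (u (mirror l z) powr (p - 1) - u z powr (p - 1)) + f (u (mirror l z)) - f (u z))))"
proof -
  have "has_lap (U l) z (- (\<gamma> * w (mirror l z) * u (mirror l z) powr (p - 1) + f (u (mirror l z))) - - (\<gamma> * w z * u z powr (p - 1) + f (u z)))"
    unfolding U_def by (intro has_lap_diff has_lap_mirror lap_u)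
  then show ?thesis by (simp add: W_def algebra_simps)
qed

lemma lap_W: "has_lap (W l) z (u z powr p - u (mirror l z) powr p)"
proof -
  have "has_lap (W l) z (- (u (mirror l z) powr p) - - (u z powr p))"
    unfolding W_def by (intro has_lap_diff has_lap_mirror lap_w)
  then show ?thesis by (simp add: algebra_simps)
qed

lemma eventually_left: "Re x < l \<Longrightarrow> \<forall>\<^sub>F z in nhds x. Re z \<le> l"
proof -
  assume "Re x < l"
  then have "\<forall>\<^sub>F z in nhds x. z \<in> {z. Re z < l}"
    by (intro eventually_nhds_in_open open_halfspace_Re_lt) auto
  then show ?thesis by eventually_elim auto
qed

text \<open>Where \<open>u (mirror l z) < u z\<close>, the Laplacian of \<open>W l\<close> is at
  most \<open>p * u z powr (p - 1) * s\<close>, which decays exponentially to the left. Adding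
  \<open>K * s * (exp (\<beta> * l) - exp (\<beta> * Re z))\<close> makes \<open>W l\<close>
  superharmonic and changes nothing on the line, so \<open>half_plane_minimum\<close>
  applies.\<close>

lemma W_lower_bound:
  obtains K \<beta> where "K > 0" "\<beta> > 0"
    "\<And>l s z. s \<ge> 0 \<Longrightarrow> (\<And>z. Re z \<le> l \<Longrightarrow> - s \<le> U l z) \<Longrightarrow> Re z \<le> l \<Longrightarrow>
       - (K * s * (exp (\<beta> * l) - exp (\<beta> * Re z))) \<le> W l z"
proof -
  obtain C \<beta> where C: "C > 0" "\<beta> > 0" and dec: "\<And>z. u z \<le> C * exp (- \<beta> * cmod z)" by (rule u_decay) blast
  obtain Kw where Kw: "Kw > 0" "\<And>z. - Kw - Kw * ln (1 + cmod z) \<le> w z" by (rule w_lower) blast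
  obtain M where M: "M \<ge> 0" "\<And>z. w z \<le> M" by (rule w_bounded_above) blast
  \<comment> \<open>Chosen so that \<open>p * u z powr (p - 1) \<le> K * \<beta>\<^sup>2 * exp
    (\<beta> * Re z)\<close>, by decay and \<open>- cmod z \<le> Re z\<close>; times
    \<open>s\<close>, the right side is minus the Laplacian of the added function.\<close>
  define K where "K = p * N powr (p - 2) * C / \<beta>\<^sup>2"
  have K: "K > 0" using p N_pos C by (simp add: K_def)
  have upow: "p * u z powr (p - 1) \<le> K * \<beta>\<^sup>2 * exp (\<beta> * Re z)" for z
  proof -
    have "u z powr (p - 1) = u z powr (p - 2) * u z"
      using powr_mult_base[of "u z" "p - 2"] upos[of z] by (simp add: mult.commute)
    also have "\<dots> \<le> N powr (p - 2) * (C * exp (- \<beta> * cmod z))"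
      using upos[of z] u_le[of z] p dec by (intro mult_mono powr_mono2) (auto simp: less_imp_le)
    also have "\<dots> \<le> N powr (p - 2) * (C * exp (\<beta> * Re z))"
    proof -
      have "- cmod z \<le> Re z" using abs_Re_le_cmod[of z] by linarith
      from mult_left_mono[OF this, of \<beta>] show ?thesis using C by (intro mult_left_mono) auto
    qed
    finally have "p * u z powr (p - 1) \<le> p * (N powr (p - 2) * (C * exp (\<beta> * Re z)))"
      using p by (intro mult_left_mono) auto
    also have "\<dots> = K * \<beta>\<^sup>2 * exp (\<beta> * Re z)" using C by (simp add: K_def)
    finally show ?thesis .
  qed
  have "- (K * s * (exp (\<beta> * l) - exp (\<beta> * Re z))) \<le> W l z"
    if s: "s \<ge> 0" and Us: "\<And>z. Re z \<le> l \<Longrightarrow> - s \<le> U l z" and z: "Re z \<le> l" for l s z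
  proof -
    define Z where "Z = (\<lambda>z. W l z + K * s * (exp (\<beta> * l) - exp (\<beta> * Re z)))"
    \<comment> \<open>This constant may depend on \<open>l\<close>: it only certifies the admissible
      growth and does not enter the conclusion of \<open>half_plane_minimum\<close>.\<close>
    define K' where "K' = Kw + Kw * ln (1 + 2 * \<bar>l\<bar>) + M"
    have lnn: "ln (1 + 2 * \<bar>l\<bar>) \<ge> 0" by simp
    have "0 \<le> Z z"
    proof (rule half_plane_minimum[where l = l and K = K'])
      show "continuous_on {z. Re z \<le> l} Z" unfolding Z_def by (intro continuous_intros cont_W)
      show "0 \<le> Z y" if "Re y = l" for y using W_boundary[OF that] that by (simp add: Z_def)
      show "- K' - K' * ln (1 + cmod y) \<le> Z y" if "Re y \<le> l" for y
      proof -
        have "mirror l y = of_real (2 * l) + - cnj y" by (simp add: complex_eq_iff)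
        then have "cmod (mirror l y) \<le> 2 * \<bar>l\<bar> + cmod y"
          using norm_triangle_ineq[of "of_real (2 * l)" "- cnj y"] by (simp add: norm_mult)
        moreover have "(1 + 2 * \<bar>l\<bar>) * (1 + cmod y) = 1 + (2 * \<bar>l\<bar> + cmod y) + 2 * (\<bar>l\<bar> * cmod y)"
          by (simp add: algebra_simps)
        moreover have "0 \<le> \<bar>l\<bar> * cmod y" by simp
        ultimately have "1 + cmod (mirror l y) \<le> (1 + 2 * \<bar>l\<bar>) * (1 + cmod y)" by linarith
        then have "ln (1 + cmod (mirror l y)) \<le> ln ((1 + 2 * \<bar>l\<bar>) * (1 + cmod y))"
          by (subst ln_le_cancel_iff) (auto intro!: mult_pos_pos add_pos_nonneg)
        also have "\<dots> = ln (1 + 2 * \<bar>l\<bar>) + ln (1 + cmod y)"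
          by (rule ln_mult_pos) (auto intro: add_pos_nonneg)
        finally have "Kw * ln (1 + cmod (mirror l y)) \<le> Kw * (ln (1 + 2 * \<bar>l\<bar>) + ln (1 + cmod y))"
          using Kw by (intro mult_left_mono) auto
        moreover have "- Kw - Kw * ln (1 + cmod (mirror l y)) \<le> w (mirror l y)" by (rule Kw(2))
        moreover have "Kw * ln (1 + cmod y) \<le> K' * ln (1 + cmod y)"
          using Kw M lnn by (intro mult_right_mono) (auto simp: K'_def)
        moreover have "0 \<le> K * s * (exp (\<beta> * l) - exp (\<beta> * Re y))"
          using K s that C by (intro mult_nonneg_nonneg) auto
        ultimately show ?thesis using M(2)[of y] unfolding Z_def W_def K'_def
          by (simp add: distrib_left)
      qed
      show "\<exists>a\<le>0. has_lap Z y a" if y: "Re y < l" for y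
      proof -
        have "has_lap Z y ((u y powr p - u (mirror l y) powr p) + K * s * (0 - (\<beta>\<^sup>2 + 0\<^sup>2) * exp (\<beta> * Re y + 0 * Im y)))"
          unfolding Z_def
          using has_lap_add[OF lap_W has_lap_cmult[OF has_lap_diff[OF has_lap_const has_lap_exp_linear[of \<beta> 0]]]]
          by simp
        moreover have "u y powr p - u (mirror l y) powr p \<le> K * s * (\<beta>\<^sup>2 * exp (\<beta> * Re y))"
        proof (cases "u y \<le> u (mirror l y)")
          case True
          then have "u y powr p \<le> u (mirror l y) powr p" using upos[of y] p by (intro powr_mono2) auto
          moreover have "0 \<le> K * s * (\<beta>\<^sup>2 * exp (\<beta> * Re y))" using K s by simp
          ultimately show ?thesis by linarith
        next
          case False
          have "u y powr p - u (mirror l y) powr p \<le> p * u y powr (p - 1) * (u y - u (mirror l y))"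
            by (rule powr_diff_le) (use upos False p in auto)
          also have "\<dots> \<le> (K * \<beta>\<^sup>2 * exp (\<beta> * Re y)) * s"
            using Us[of y] y False K by (intro mult_mono[OF upow]) (auto simp: U_def)
          finally show ?thesis by (simp add: mult_ac)
        qed
        then have "(u y powr p - u (mirror l y) powr p) + K * s * (0 - (\<beta>\<^sup>2 + 0\<^sup>2) * exp (\<beta> * Re y + 0 * Im y)) \<le> 0"
          by simp
        ultimately show ?thesis by blast
      qed
    qed (use z in auto)
    then show ?thesis by (simp add: Z_def)
  qed
  then show ?thesis using that K C by blast
qed

lemma W_nonneg:
  assumes "\<And>z. Re z \<le> l \<Longrightarrow> 0 \<le> U l z" "Re z \<le> l"
  shows "0 \<le> W l z"
proof -
  obtain K \<beta> where "\<And>l s z. s \<ge> 0 \<Longrightarrow> (\<And>z. Re z \<le> l \<Longrightarrow> - s \<le> U l z) \<Longrightarrow> Re z \<le> l \<Longrightarrow>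
       - (K * s * (exp (\<beta> * l) - exp (\<beta> * Re z))) \<le> W l z"
    by (rule W_lower_bound) blast
  from this[of 0 l z] show ?thesis using assms by simp
qed

text \<open>At a negative minimum of \<open>U\<close>, coercivity forces \<open>W\<close> to be comparably negative, which by the
  bound on \<open>W\<close> is only possible where \<open>u\<close> is not small.\<close>

lemma negative_min_bounded:
  obtains R where "R > 0"
    "\<And>l x. l \<le> \<Lambda> \<Longrightarrow> Re x < l \<Longrightarrow> U l x < 0 \<Longrightarrow> (\<And>z. Re z \<le> l \<Longrightarrow> U l x \<le> U l z) \<Longrightarrow> cmod x < R"
proof -
  obtain K \<beta> where K: "K > 0" "\<beta> > 0" and Wl: "\<And>l s z. s \<ge> 0 \<Longrightarrow> (\<And>z. Re z \<le> l \<Longrightarrow> - s \<le> U l z) \<Longrightarrow> Re z \<le> l \<Longrightarrow>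
       - (K * s * (exp (\<beta> * l) - exp (\<beta> * Re z))) \<le> W l z"
    by (rule W_lower_bound) blast
  obtain C b where C: "C > 0" "b > 0" and dec: "\<And>z. u z \<le> C * exp (- b * cmod z)" by (rule u_decay) blast
  obtain a R1 where a: "a > 0" "R1 \<ge> 0"
    and co: "\<And>z b. R1 \<le> cmod z \<Longrightarrow> 0 < b \<Longrightarrow> b < u z \<Longrightarrow>
      a * (u z - b) \<le> \<gamma> * w z * (b powr (p - 1) - u z powr (p - 1)) + f b - f (u z)"
    by (rule coercive) blast
  \<comment> \<open>With \<open>k\<close>, the term of \<open>W\<close> at a minimum of value
    \<open>- s\<close> is at least \<open>- (k * u x * s)\<close>, whereas coercivity yields
    \<open>a * s\<close>. Hence a contradiction as soon as \<open>k * u x < a\<close>, which holds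
    beyond radius \<open>R2\<close>.\<close>
  define k where "k = \<gamma> * K * exp (\<beta> * \<Lambda>) * N powr (p - 2)"
  have k: "k > 0" using \<gamma> K N_pos by (simp add: k_def)
  obtain R2 where R2: "\<And>r. R2 \<le> r \<Longrightarrow> 1 < (a / (k * C)) * exp (b * r)"
    by (rule exp_exceeds_one[of "a / (k * C)" b]) (use a k C in auto)
  have small: "k * u x < a" if "R2 \<le> cmod x" for x
  proof -
    have "k * C < a * exp (b * cmod x)" using R2[OF that] k C by (simp add: field_simps)
    then have "k * (C * exp (- b * cmod x)) < a" by (simp add: exp_minus field_simps)
    moreover have "k * u x \<le> k * (C * exp (- b * cmod x))" using dec k by (intro mult_left_mono) auto
    ultimately show ?thesis by linarith
  qed
  have "cmod x < max 1 (max R1 R2)" if l: "l \<le> \<Lambda>" and x: "Re x < l" and neg: "U l x < 0"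
    and mn: "\<And>z. Re z \<le> l \<Longrightarrow> U l x \<le> U l z" for l x
  proof (rule ccontr)
    assume "\<not> cmod x < max 1 (max R1 R2)"
    then have xR: "R1 \<le> cmod x" "R2 \<le> cmod x" by auto
    define s where "s = - U l x"
    have s: "s > 0" using neg by (simp add: s_def)
    have b: "0 < u (mirror l x)" "u (mirror l x) < u x" using upos neg by (auto simp: U_def)
    have "- (K * s * (exp (\<beta> * l) - exp (\<beta> * Re x))) \<le> W l x"
      by (rule Wl) (use s mn x in \<open>auto simp: s_def\<close>)
    moreover have "K * s * (exp (\<beta> * l) - exp (\<beta> * Re x)) \<le> K * s * exp (\<beta> * \<Lambda>)"
    proof (rule mult_left_mono)
      have "exp (\<beta> * l) \<le> exp (\<beta> * \<Lambda>)" using K l by simp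
      then show "exp (\<beta> * l) - exp (\<beta> * Re x) \<le> exp (\<beta> * \<Lambda>)" using exp_gt_zero[of "\<beta> * Re x"] by linarith
    qed (use K s in auto)
    ultimately have Wx: "- (K * s * exp (\<beta> * \<Lambda>)) \<le> W l x" by linarith
    have "\<forall>\<^sub>F z in nhds x. U l x \<le> U l z"
      using eventually_left[OF x] by eventually_elim (rule mn)
    from has_lap_local_min[OF lap_U this]
    have "\<gamma> * W l x * u (mirror l x) powr (p - 1) + (\<gamma> * w x * (u (mirror l x) powr (p - 1) - u x powr (p - 1)) + f (u (mirror l x)) - f (u x)) \<le> 0"
      by simp
    moreover have "a * s \<le> \<gamma> * w x * (u (mirror l x) powr (p - 1) - u x powr (p - 1)) + f (u (mirror l x)) - f (u x)"
      using co[OF xR(1) b] by (simp add: s_def U_def)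
    moreover have "- (k * u x * s) \<le> \<gamma> * W l x * u (mirror l x) powr (p - 1)"
    proof -
      have "u (mirror l x) powr (p - 1) \<le> u x powr (p - 1)" using b p by (intro powr_mono2) auto
      also have "\<dots> = u x powr (p - 2) * u x"
        using powr_mult_base[of "u x" "p - 2"] upos[of x] by (simp add: mult.commute)
      also have "\<dots> \<le> N powr (p - 2) * u x"
        using upos[of x] u_le[of x] p by (intro mult_right_mono powr_mono2) auto
      finally have 1: "u (mirror l x) powr (p - 1) \<le> N powr (p - 2) * u x" .
      have "(\<gamma> * (K * s * exp (\<beta> * \<Lambda>))) * u (mirror l x) powr (p - 1) \<le> (\<gamma> * (K * s * exp (\<beta> * \<Lambda>))) * (N powr (p - 2) * u x)"
        by (rule mult_left_mono[OF 1]) (use \<gamma> K s in auto)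
      also have "\<dots> = k * u x * s" by (simp add: k_def mult_ac)
      finally have 2: "(\<gamma> * (K * s * exp (\<beta> * \<Lambda>))) * u (mirror l x) powr (p - 1) \<le> k * u x * s" .
      have "\<gamma> * (- (K * s * exp (\<beta> * \<Lambda>))) \<le> \<gamma> * W l x" using Wx \<gamma> by (intro mult_left_mono) auto
      then have "\<gamma> * (- (K * s * exp (\<beta> * \<Lambda>))) * u (mirror l x) powr (p - 1) \<le> \<gamma> * W l x * u (mirror l x) powr (p - 1)"
        by (rule mult_right_mono) simp
      with 2 show ?thesis by simp
    qed
    ultimately have "a * s \<le> k * u x * s" by linarith
    moreover have "k * u x * s < a * s" using small[OF xR(2)] s by (intro mult_strict_right_mono)
    ultimately show False by linarith
  qed
  then show ?thesis using that[of "max 1 (max R1 R2)"] by auto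
qed

text \<open>The reflected \<open>u\<close> is positive, so \<open>U l z > - u z\<close>; by decay of
  \<open>u\<close> this exceeds any given negative number far out, and the minimum is attained. On
  the line \<open>U l\<close> vanishes, so the minimum lies off it.\<close>

lemma negative_min_exists:
  assumes "Re z0 \<le> l" "U l z0 < 0"
  obtains x where "Re x < l" "U l x < 0" "\<And>z. Re z \<le> l \<Longrightarrow> U l x \<le> U l z"
proof -
  obtain C b where C: "C > 0" "b > 0" and dec: "\<And>z. u z \<le> C * exp (- b * cmod z)" by (rule u_decay) blast
  have "- U l z0 / C > 0" by (rule divide_pos_pos) (use assms C in auto)
  then obtain K where K: "\<And>r. K \<le> r \<Longrightarrow> 1 < (- U l z0 / C) * exp (b * r)"
    using exp_exceeds_one C by blast
  have out: "U l z0 \<le> U l z" if "cmod z \<ge> K" for z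
  proof -
    have "C < - U l z0 * exp (b * cmod z)" using K[OF that] C by (simp add: field_simps)
    then have "C * exp (- b * cmod z) < - U l z0" by (simp add: exp_minus field_simps)
    then show ?thesis using dec[of z] upos[of "mirror l z"] by (simp add: U_def)
  qed
  obtain x where x: "Re x \<le> l" "\<And>z. Re z \<le> l \<Longrightarrow> U l x \<le> U l z"
    by (rule attains_min_closed[OF closed_halfspace_Re_le[of l] cont_U, of z0 K l]) (use assms out in auto)
  have neg: "U l x < 0" using x(2)[OF assms(1)] assms(2) by linarith
  then have "Re x < l" using U_boundary[of x l] x(1) by (cases "Re x = l") auto
  then show ?thesis using that x neg by blast
qed

text \<open>Once \<open>U l\<close> is nonnegative, so is \<open>W l\<close>, and its term has the
  favourable sign. The rest is Lipschitz in \<open>U l\<close>: here \<open>p - 1 \<ge> 1\<close>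
  bounds the slope of the power, and \<open>C\<close> contains a bound for \<open>w\<close> on the
  disc.\<close>

lemma local_supersolution:
  assumes "\<And>z. Re z \<le> l \<Longrightarrow> 0 \<le> U l z"
  obtains C where "\<And>z. z \<in> ball y r \<Longrightarrow> Re z \<le> l \<Longrightarrow> \<exists>a. has_lap (U l) z a \<and> a \<le> C * U l z"
proof -
  obtain L where L: "L > 0" "\<And>a b. 0 \<le> a \<Longrightarrow> a \<le> N \<Longrightarrow> 0 \<le> b \<Longrightarrow> b \<le> N \<Longrightarrow> \<bar>f a - f b\<bar> \<le> L * \<bar>a - b\<bar>"
    by (rule f_lipschitz) blast
  have "compact (w ` cball y r)" by (intro compact_continuous_image cont_w compact_cball)
  then obtain B where B: "\<And>z. z \<in> cball y r \<Longrightarrow> \<bar>w z\<bar> \<le> B"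
    using compact_imp_bounded[of "w ` cball y r"] unfolding bounded_iff by (metis imageI real_norm_def)
  define C where "C = \<gamma> * B * ((p - 1) * N powr (p - 2)) + L"
  have "\<exists>a. has_lap (U l) z a \<and> a \<le> C * U l z" if z: "z \<in> ball y r" "Re z \<le> l" for z
  proof (intro exI conjI, rule lap_U)
    have U0: "0 \<le> U l z" using assms z by simp
    have le: "u z \<le> u (mirror l z)" using U0 by (simp add: U_def)
    have Bz: "\<bar>w z\<bar> \<le> B" using B z by auto
    have "0 \<le> \<gamma> * W l z * u (mirror l z) powr (p - 1)"
      using W_nonneg[OF assms] z \<gamma> by (intro mult_nonneg_nonneg) auto
    moreover have "f (u z) - f (u (mirror l z)) \<le> L * U l z"
      using L(2)[of "u z" "u (mirror l z)"] upos[of z] upos[of "mirror l z"] u_le le by (simp add: U_def abs_le_iff less_imp_le)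
    moreover have "- (\<gamma> * w z * (u (mirror l z) powr (p - 1) - u z powr (p - 1))) \<le> \<gamma> * B * ((p - 1) * N powr (p - 2)) * U l z"
    proof -
      have "u (mirror l z) powr (p - 1) - u z powr (p - 1) \<le> (p - 1) * u (mirror l z) powr (p - 1 - 1) * (u (mirror l z) - u z)"
        by (rule powr_diff_le) (use upos le p in auto)
      also have "\<dots> \<le> (p - 1) * N powr (p - 2) * (u (mirror l z) - u z)"
        using p le u_le upos[of "mirror l z"] by (intro mult_right_mono mult_left_mono) (auto intro!: powr_mono2)
      finally have 1: "u (mirror l z) powr (p - 1) - u z powr (p - 1) \<le> (p - 1) * N powr (p - 2) * U l z" by (simp add: U_def)
      have 2: "0 \<le> u (mirror l z) powr (p - 1) - u z powr (p - 1)"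
        using le upos[of z] p by (simp add: powr_mono2)
      have "- (\<gamma> * w z * (u (mirror l z) powr (p - 1) - u z powr (p - 1))) = (\<gamma> * (- w z)) * (u (mirror l z) powr (p - 1) - u z powr (p - 1))" by simp
      also have "\<dots> \<le> (\<gamma> * B) * (u (mirror l z) powr (p - 1) - u z powr (p - 1))"
        using Bz \<gamma> by (intro mult_right_mono[OF _ 2] mult_left_mono) auto
      also have "\<dots> \<le> (\<gamma> * B) * ((p - 1) * N powr (p - 2) * U l z)"
        using Bz \<gamma> by (intro mult_left_mono[OF 1]) auto
      finally show ?thesis by (simp add: mult_ac)
    qed
    ultimately show "- (\<gamma> * W l z * u (mirror l z) powr (p - 1)
    + (\<gamma> * w z * (u (mirror l z) powr (p - 1) - u z powr (p - 1)) + f (u (mirror l z)) - f (u z))) \<le> C * U l z"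
      by (simp add: C_def algebra_simps)
  qed
  then show ?thesis using that by blast
qed

section \<open>Strong minimum principle and Hopf's lemma for \<open>U\<close>\<close>

lemma u_has_derivative: "(u has_derivative (\<lambda>h. u1 z * Re h + u2 z * Im h)) (at z)"
  using cu by (auto simp: c2fun_def)

lemma U_has_derivative:
  "(U l has_derivative (\<lambda>h. (u1 (mirror l z) * (- Re h) + u2 (mirror l z) * Im h) - (u1 z * Re h + u2 z * Im h))) (at z)"
proof -
  have mirror: "mirror l = (\<lambda>z. of_real (2 * l) - cnj z)" by (auto simp: complex_eq_iff fun_eq_iff)
  have "(mirror l has_derivative (\<lambda>h. - cnj h)) (at z)"
    unfolding mirror by (auto intro!: derivative_eq_intros)
  from has_derivative_compose[OF this u_has_derivative]
  have "((\<lambda>z. u (mirror l z)) has_derivative (\<lambda>h. u1 (mirror l z) * (- Re h) + u2 (mirror l z) * Im h)) (at z)" by simp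
  from has_derivative_diff[OF this u_has_derivative] show ?thesis unfolding U_def .
qed

lemma U_dichotomy:
  assumes nn: "\<And>z. Re z \<le> l \<Longrightarrow> 0 \<le> U l z" and a: "Re a < l" "U l a = 0" and b: "Re b < l"
  shows "U l b = 0"
proof (rule strong_minimum_principle[of l "U l" a b])
  show "\<exists>C. \<forall>z\<in>ball y r. \<exists>a. has_lap (U l) z a \<and> a \<le> C * U l z"
    if "0 < r" "cball y r \<subseteq> {z. Re z < l}" for y r
  proof -
    obtain C where "\<And>z. z \<in> ball y r \<Longrightarrow> Re z \<le> l \<Longrightarrow> \<exists>a. has_lap (U l) z a \<and> a \<le> C * U l z"
      using local_supersolution[of l y r] nn by blast
    moreover have "Re z \<le> l" if "z \<in> ball y r" for z
      using that \<open>cball y r \<subseteq> {z. Re z < l}\<close> ball_subset_cball[of y r] by fastforce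
    ultimately show ?thesis by blast
  qed
  show "U l differentiable at z" for z using U_has_derivative unfolding differentiable_def by blast
qed (use assms in auto)

text \<open>On the line of reflection the derivative of \<open>U l\<close> in direction
  \<open>-1\<close> is \<open>2 * u1 x\<close>, and the unit disc about \<open>x - 1\<close> touches
  the line at \<open>x\<close> from inside the half-plane.\<close>

lemma U_hopf:
  assumes nn: "\<And>z. Re z \<le> l \<Longrightarrow> 0 \<le> U l z" and pos: "\<And>z. Re z < l \<Longrightarrow> 0 < U l z" and x: "Re x = l"
  shows "u1 x > 0"
proof -
  let ?y = "x - 1"
  have ball: "Re z < l" if "z \<in> ball ?y 1" for z
    using that abs_Re_le_cmod[of "?y - z"] x by (auto simp: dist_norm abs_le_iff)
  have cball: "Re z \<le> l" if "z \<in> cball ?y 1" for z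
    using that abs_Re_le_cmod[of "?y - z"] x by (auto simp: dist_norm abs_le_iff)
  obtain C where C: "\<And>z. z \<in> ball ?y 1 \<Longrightarrow> Re z \<le> l \<Longrightarrow> \<exists>a. has_lap (U l) z a \<and> a \<le> C * U l z"
    using local_supersolution[of l ?y 1] nn by blast
  obtain c where c: "c > 0" "\<And>t. 0 \<le> t \<Longrightarrow> t \<le> 1/2 \<Longrightarrow> c * t \<le> U l (x + of_real t * (?y - x))"
    by (rule hopf_boundary_growth[of 1 ?y "U l" C x])
       (use nn pos ball cball C cont_U in \<open>auto simp: less_imp_le\<close>)
  have r: "mirror l x = x" using x by (simp add: complex_eq_iff)
  have "(u1 (mirror l x) * (- Re (?y - x)) + u2 (mirror l x) * Im (?y - x)) - (u1 x * Re (?y - x) + u2 x * Im (?y - x)) > 0"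
    by (rule linear_growth_deriv_pos[OF line_derivative[OF U_has_derivative] _ c]) (simp_all add: U_boundary x)
  then show ?thesis by (simp add: r)
qed

section \<open>Moving the line from the far left to its final position\<close>

definition good where "good l \<longleftrightarrow> (\<forall>z. Re z \<le> l \<longrightarrow> 0 \<le> U l z)"

text \<open>For \<open>l \<le> - R\<close> the half-plane left of the line does not meet the disc of
  radius \<open>R\<close> to which negative minima are confined.\<close>

lemma good_far: "\<exists>l0. \<forall>l\<le>l0. good l"
proof -
  obtain R where R: "R > 0"
    "\<And>l x. l \<le> 0 \<Longrightarrow> Re x < l \<Longrightarrow> U l x < 0 \<Longrightarrow> (\<And>z. Re z \<le> l \<Longrightarrow> U l x \<le> U l z) \<Longrightarrow> cmod x < R"
    using negative_min_bounded[of 0] by blast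
  have "good l" if l: "l \<le> - R" for l
  proof (rule ccontr)
    assume "\<not> good l"
    then obtain z0 where "Re z0 \<le> l" "U l z0 < 0" by (auto simp: good_def not_le)
    then obtain x where x: "Re x < l" "U l x < 0" "\<And>z. Re z \<le> l \<Longrightarrow> U l x \<le> U l z"
      by (rule negative_min_exists) blast
    have "cmod x < R" by (rule R(2)[OF _ x]) (use l R in auto)
    then show False using x(1) l abs_Re_le_cmod[of x] by linarith
  qed
  then show ?thesis by blast
qed

text \<open>A good \<open>l\<close> has \<open>W l 0 \<ge> 0\<close>, that is
  \<open>w (of_real (2 * l)) \<ge> w 0\<close>, which fails for large \<open>l\<close> since
  \<open>w\<close> tends to minus infinity.\<close>

lemma good_bounded: "\<exists>B. \<forall>l. good l \<longrightarrow> l \<le> B"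
proof -
  obtain R where R: "R \<ge> 0" "\<And>z. R \<le> cmod z \<Longrightarrow> w z \<le> w 0 - 1" by (rule w_small[of "w 0 - 1"]) blast
  have "l \<le> R" if g: "good l" for l
  proof (rule ccontr)
    assume "\<not> l \<le> R"
    then have l: "l > R" by simp
    have "0 \<le> W l 0" using g l R by (intro W_nonneg) (auto simp: good_def)
    moreover have "mirror l 0 = of_real (2 * l)" by (simp add: complex_eq_iff)
    moreover have "w (of_real (2 * l)) \<le> w 0 - 1" using l R by (intro R(2)) (simp add: norm_mult)
    ultimately show False by (simp add: W_def)
  qed
  then show ?thesis by blast
qed

text \<open>Where \<open>U l\<close> vanishes identically each point is both a minimum and a
  maximum, so the test applied to \<open>U l\<close> and to its negative gives two opposite
  inequalities. What remains of the equation is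
  \<open>\<gamma> * W l z * u z powr (p - 1) = 0\<close>, and \<open>u\<close> is positive.\<close>

lemma symmetric_of_zero:
  assumes zero: "\<And>z. Re z < l \<Longrightarrow> U l z = 0"
  shows "u (mirror l z) = u z" "w (mirror l z) = w z"
proof -
  have W0: "W l z = 0" if z: "Re z < l" for z
  proof -
    have "\<forall>\<^sub>F y in nhds z. y \<in> {y. Re y < l}"
      using z by (intro eventually_nhds_in_open open_halfspace_Re_lt) auto
    then have ev: "\<forall>\<^sub>F y in nhds z. U l y = 0" by eventually_elim (use zero in auto)
    have "\<forall>\<^sub>F y in nhds z. U l z \<le> U l y" using ev by eventually_elim (use zero z in auto)
    from has_lap_local_min[OF lap_U this]
    have 1: "\<gamma> * W l z * u (mirror l z) powr (p - 1) + (\<gamma> * w z * (u (mirror l z) powr (p - 1) - u z powr (p - 1)) + f (u (mirror l z)) - f (u z)) \<le> 0"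
      by simp
    have "\<forall>\<^sub>F y in nhds z. - U l z \<le> - U l y" using ev by eventually_elim (use zero z in auto)
    from has_lap_local_min[OF has_lap_minus[OF lap_U] this]
    have 2: "0 \<le> \<gamma> * W l z * u (mirror l z) powr (p - 1) + (\<gamma> * w z * (u (mirror l z) powr (p - 1) - u z powr (p - 1)) + f (u (mirror l z)) - f (u z))"
      by simp
    have "u (mirror l z) = u z" using zero[OF z] by (simp add: U_def)
    then have "\<gamma> * W l z * u z powr (p - 1) = 0" using 1 2 by simp
    then show ?thesis using \<gamma> upos[of z] by simp
  qed
  consider "Re z < l" | "Re z = l" | "Re (mirror l z) < l" by fastforce
  then have "U l z = 0 \<and> W l z = 0 \<or> U l (mirror l z) = 0 \<and> W l (mirror l z) = 0"
    using zero W0 U_boundary W_boundary by cases auto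
  then show "u (mirror l z) = u z" "w (mirror l z) = w z" by (auto simp: U_def W_def)
qed

lemma continuous_U2: "continuous_on UNIV (\<lambda>x. U (fst x) (snd x))"
  unfolding U_def
  by (intro continuous_intros continuous_on_compose2[OF cont_u[of UNIV] continuous_mirror2]
     continuous_on_compose2[OF cont_u[of UNIV] continuous_on_snd[OF continuous_on_id]]) auto

text \<open>The normal derivative of \<open>U l\<close> at an interior minimum, written as an
  equation that is continuous in \<open>l\<close> and \<open>x\<close>. It survives the limit even
  if the minima run into the line, where it reads \<open>2 * u1 x = 0\<close>.\<close>

lemma U_critical:
  assumes x: "Re x < l" and mn: "\<And>z. Re z \<le> l \<Longrightarrow> U l x \<le> U l z"
  shows "u1 (mirror l x) + u1 x = 0"
proof -
  have "\<forall>\<^sub>F z in nhds x. U l x \<le> U l z" using eventually_left[OF x] by eventually_elim (rule mn)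
  from eventually_compose_filterlim[OF this filterlim_line[of x 1]]
  obtain e where e: "e > 0" "\<And>t. \<bar>t\<bar> < e \<Longrightarrow> U l x \<le> U l (x + of_real t * 1)"
    unfolding eventually_nhds_metric by (auto simp: dist_real_def)
  have "(u1 (mirror l x) * (- Re 1) + u2 (mirror l x) * Im 1) - (u1 x * Re 1 + u2 x * Im 1) = 0"
    by (rule DERIV_local_min[OF line_derivative[OF U_has_derivative] e(1)]) (use e(2) in auto)
  then show ?thesis by simp
qed

theorem moving_plane:
  "\<exists>l. (\<forall>z. u (mirror l z) = u z \<and> w (mirror l z) = w z) \<and>
     (\<forall>m<l. \<forall>z. Re z < m \<longrightarrow> u z < u (mirror m z) \<and> w z < w (mirror m z))"
proof -
  \<comment> \<open>Requiring all smaller positions as well makes \<open>S\<close> an initial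
    interval; failure beyond \<open>l\<close> then supplies bad positions converging to
    \<open>l\<close> from above.\<close>
  define S where "S = {l. \<forall>m\<le>l. good m}"
  define l where "l = Sup S"
  have Sne: "S \<noteq> {}" using good_far by (auto simp: S_def)
  have Sbd: "bdd_above S" using good_bounded by (auto simp: S_def bdd_above_def)
  have below: "good m" if "m < l" for m
  proof -
    obtain s where "s \<in> S" "m < s" using \<open>m < l\<close> less_cSup_iff[OF Sne Sbd] unfolding l_def by blast
    then show ?thesis by (simp add: S_def)
  qed
  have goodl: "good l"
    unfolding good_def
  proof (intro allI impI)
    fix z assume z: "Re z \<le> l"
    show "0 \<le> U l z"
    proof (cases "Re z = l")
      case True then show ?thesis by (simp add: U_boundary)
    next
      case False
      have "((\<lambda>m. U m z) \<longlongrightarrow> U l z) (at_left l)"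
      proof -
        have "continuous_on UNIV (\<lambda>m. U m z)"
          using continuous_on_compose2[OF continuous_U2, of UNIV "\<lambda>m. (m, z)"]
          by (simp add: continuous_on_Pair)
        then have "isCont (\<lambda>m. U m z) l" by (simp add: continuous_on_eq_continuous_at)
        then show ?thesis unfolding isCont_def by (rule filterlim_mono) (auto simp: at_le)
      qed
      moreover have "\<forall>\<^sub>F m in at_left l. 0 \<le> U m z"
        using eventually_at_left_real[of "Re z" l] False z
        by (auto elim!: eventually_mono dest!: below simp: good_def)
      ultimately show ?thesis by (rule tendsto_lowerbound) simp
    qed
  qed
  obtain R where R: "R > 0"
    "\<And>m x. m \<le> l + 1 \<Longrightarrow> Re x < m \<Longrightarrow> U m x < 0 \<Longrightarrow> (\<And>z. Re z \<le> m \<Longrightarrow> U m x \<le> U m z) \<Longrightarrow> cmod x < R"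
    using negative_min_bounded[of "l + 1"] by blast
  \<comment> \<open>All bad positions are at most \<open>l + 1\<close>, the bound for which
    \<open>R\<close> was chosen, so their minima share one compact disc.\<close>
  have "\<exists>m x. l < m \<and> m \<le> l + 1 / real (Suc n) \<and> Re x < m \<and> U m x < 0 \<and> cmod x < R \<and> u1 (mirror m x) + u1 x = 0" for n
  proof -
    have "l + 1 / real (Suc n) \<notin> S" using cSup_upper[OF _ Sbd] l_def by force
    then obtain m where m: "m \<le> l + 1 / real (Suc n)" "\<not> good m" by (auto simp: S_def)
    then have ml: "l < m" using below goodl by (metis linorder_cases)
    obtain z0 where "Re z0 \<le> m" "U m z0 < 0" using m(2) by (auto simp: good_def not_le)
    then obtain x where x: "Re x < m" "U m x < 0" "\<And>z. Re z \<le> m \<Longrightarrow> U m x \<le> U m z"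
      by (rule negative_min_exists) blast
    have "1 / real (Suc n) \<le> 1" by simp
    then have "m \<le> l + 1" using m(1) by linarith
    from R(2)[OF this x] U_critical[OF x(1,3)] x(1,2) m(1) ml show ?thesis by blast
  qed
  then obtain m x where mx: "\<And>n. l < m n" "\<And>n. m n \<le> l + 1 / real (Suc n)" "\<And>n. Re (x n) < m n"
    "\<And>n. U (m n) (x n) < 0" "\<And>n. cmod (x n) < R" "\<And>n. u1 (mirror (m n) (x n)) + u1 (x n) = 0"
    by metis
  have "\<forall>n. x n \<in> cball 0 R" using mx(5) by (auto simp: less_imp_le)
  then obtain y r where y: "strict_mono r" "(x \<circ> r) \<longlonglongrightarrow> y"
    using compact_cball[of "0::complex" R] unfolding compact_def by blast
  have "(\<lambda>n. l + 1 / real (Suc n)) \<longlonglongrightarrow> l + 0"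
    by (intro tendsto_add tendsto_const LIMSEQ_Suc[OF lim_inverse_n'])
  then have "m \<longlonglongrightarrow> l"
    by (intro real_tendsto_sandwich[of "\<lambda>n. l" m]) (use mx(2) in \<open>auto intro!: always_eventually less_imp_le[OF mx(1)] simp: add.commute\<close>)
  then have mr: "(m \<circ> r) \<longlonglongrightarrow> l" using y(1) by (rule LIMSEQ_subseq_LIMSEQ)
  have pr: "(\<lambda>n. ((m \<circ> r) n, (x \<circ> r) n)) \<longlonglongrightarrow> (l, y)" by (intro tendsto_Pair mr y)
  have yl: "Re y \<le> l"
    by (rule LIMSEQ_le[OF tendsto_Re[OF y(2)] mr]) (auto intro!: less_imp_le mx(3))
  have "(\<lambda>n. U (m (r n)) (x (r n))) \<longlonglongrightarrow> U l y"
    using continuous_on_tendsto_compose[OF continuous_U2 pr] by simp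
  then have "U l y \<le> 0"
    by (rule LIMSEQ_le_const2) (auto intro!: less_imp_le mx(4))
  then have Uy: "U l y = 0" using goodl yl unfolding good_def by force
  have cu1: "continuous_on UNIV u1" using cu by (simp add: c2fun_def)
  have crit: "u1 (mirror l y) + u1 y = 0"
  proof -
    have "continuous_on UNIV (\<lambda>x. u1 (mirror (fst x) (snd x)) + u1 (snd x))"
      by (intro continuous_intros continuous_on_compose2[OF cu1 continuous_mirror2]
          continuous_on_compose2[OF cu1 continuous_on_snd[OF continuous_on_id]]) auto
    from continuous_on_tendsto_compose[OF this pr]
    have "(\<lambda>n. u1 (mirror (m (r n)) (x (r n))) + u1 (x (r n))) \<longlonglongrightarrow> u1 (mirror l y) + u1 y" by simp
    then show ?thesis using mx(6) by (simp add: LIMSEQ_const_iff)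
  qed
  \<comment> \<open>Without an interior zero the limit \<open>y\<close> lies on the line and
    \<open>U l\<close> is positive to its left, so \<open>U_hopf\<close> makes \<open>u1 y\<close>
    positive, against \<open>crit\<close>.\<close>
  have "\<exists>a. Re a < l \<and> U l a = 0"
  proof (rule ccontr)
    assume no: "\<not> ?thesis"
    then have "Re y = l" using yl Uy by force
    moreover have "0 < U l z" if "Re z < l" for z
      using goodl no that unfolding good_def by (metis less_eq_real_def)
    ultimately have "u1 y > 0" using goodl by (intro U_hopf) (auto simp: good_def)
    moreover have "mirror l y = y" using \<open>Re y = l\<close> by (simp add: complex_eq_iff)
    ultimately show False using crit by simp
  qed
  then obtain a where a: "Re a < l" "U l a = 0" by blast
  have "U l z = 0" if "Re z < l" for z
    by (rule U_dichotomy[OF _ a that]) (use goodl in \<open>auto simp: good_def\<close>)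
  then have sym: "u (mirror l z) = u z" "w (mirror l z) = w z" for z using symmetric_of_zero by blast+
  have "u z < u (mirror m z) \<and> w z < w (mirror m z)" if m: "m < l" and z: "Re z < m" for m z
  proof -
    have gm: "\<And>z. Re z \<le> m \<Longrightarrow> 0 \<le> U m z" using below[OF m] by (auto simp: good_def)
    \<comment> \<open>A zero would make \<open>m\<close> a second axis of symmetry. The two
      reflections compose to a translation by \<open>2 * (l - m)\<close>, and a function with that
      period cannot tend to minus infinity.\<close>
    have pos: "0 < U m z" if z: "Re z < m" for z
    proof (rule ccontr)
      assume "\<not> 0 < U m z"
      then have "U m z = 0" using gm[of z] z by force
      then have "U m x = 0" if "Re x < m" for x using U_dichotomy[OF gm z _ that] by blast
      then have sm: "w (mirror m z) = w z" for z by (rule symmetric_of_zero(2))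
      define d where "d = 2 * (l - m)"
      have "mirror l (mirror m z) = z + of_real d" for z by (simp add: complex_eq_iff d_def)
      then have per: "w (z + of_real d) = w z" for z by (metis sym(2) sm)
      have perN: "w (of_real (real n * d)) = w 0" for n
      proof (induction n)
        case (Suc n)
        then show ?case using per[of "of_real (real n * d)"] by (simp add: algebra_simps)
      qed simp
      obtain R where R: "R \<ge> 0" "\<And>z. R \<le> cmod z \<Longrightarrow> w z \<le> w 0 - 1" by (rule w_small[of "w 0 - 1"]) blast
      have d: "d > 0" using m by (simp add: d_def)
      obtain n where "R \<le> real n * d" using real_arch_simple[of "R / d"] d by (auto simp: field_simps)
      then have "w (of_real (real n * d)) \<le> w 0 - 1" using d by (intro R(2)) (simp add: norm_mult)
      then show False using perN[of n] by simp
    qed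
    have u: "u z < u (mirror m z)" using pos[OF z] by (simp add: U_def)
    have W0: "0 \<le> W m x" if "Re x \<le> m" for x using W_nonneg[OF gm that] .
    \<comment> \<open>A zero would be an interior minimum of \<open>W m\<close>, while the Laplacian
      \<open>u z powr p - u (mirror m z) powr p\<close> is negative by the strict inequality for
      \<open>u\<close>.\<close>
    have "W m z \<noteq> 0"
    proof
      assume "W m z = 0"
      then have "\<forall>\<^sub>F y in nhds z. W m z \<le> W m y"
        using eventually_left[OF z] by (auto elim!: eventually_mono W0)
      from has_lap_local_min[OF lap_W this] have "u (mirror m z) powr p \<le> u z powr p" by simp
      moreover have "u z powr p < u (mirror m z) powr p"
        using u upos[of z] p by (intro powr_less_mono2) auto
      ultimately show False by simp
    qed
    then have "w z < w (mirror m z)" using W0[of z] z by (simp add: W_def)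
    with u show ?thesis by blast
  qed
  with sym show ?thesis by blast
qed

end

section \<open>From all directions to radial symmetry\<close>

definition v2 :: "real \<Rightarrow> real \<Rightarrow> real^2" where
  "v2 s t = s *\<^sub>R axis 1 1 + t *\<^sub>R axis 2 1"

lemma v2_nth [simp]: "v2 s t $ 1 = s" "v2 s t $ 2 = t"
  by (simp_all add: v2_def axis_def)

lemma v2_eta: "v2 (x $ 1) (x $ 2) = x"
  by (simp add: vec_eq_iff forall_2)

lemma partial_along_line:
  assumes "has_pd i f"
  shows "((\<lambda>t. f (x + t *\<^sub>R axis i 1)) has_real_derivative pd i f (x + t *\<^sub>R axis i 1)) (at t)"
proof -
  have *: "((\<lambda>t. f (y + t *\<^sub>R axis i 1)) has_real_derivative pd i f y) (at 0)" for y
    using assms unfolding has_pd_def pd_def by (simp add: DERIV_deriv_iff_real_differentiable)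
  have "((\<lambda>h. f (x + (h + t) *\<^sub>R axis i 1)) has_real_derivative pd i f (x + t *\<^sub>R axis i 1)) (at 0)"
    using *[of "x + t *\<^sub>R axis i 1"] by (simp add: algebra_simps)
  then show ?thesis using DERIV_at_within_shift[of "\<lambda>t. f (x + t *\<^sub>R axis i 1)" _ t 0 UNIV]
    by (simp add: add.commute)
qed

text \<open>The map is carried to pairs of reals, where existence of the first partial and
  continuity of the second give the total derivative.\<close>

lemma has_derivative_of_continuous_partials:
  assumes pd: "has_pd 1 f" "has_pd 2 f" and c: "continuous_on UNIV (pd 2 f)"
  shows "(f has_derivative (\<lambda>h. pd 1 f x * h $ 1 + pd 2 f x * h $ 2)) (at x)"
proof -
  have v1: "v2 s t = v2 0 t + s *\<^sub>R axis 1 1" and v2: "v2 s t = v2 s 0 + t *\<^sub>R axis 2 1" for s t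
    by (simp_all add: v2_def)
  have "((\<lambda>(s, t). f (v2 s t)) has_derivative
     (\<lambda>(a, b). pd 1 f (v2 (x $ 1) (x $ 2)) * a + blinfun_apply (blinfun_mult_right (pd 2 f (v2 (x $ 1) (x $ 2)))) b))
     (at (x $ 1, x $ 2) within UNIV \<times> UNIV)"
  proof (rule has_derivative_partialsI)
    show "((\<lambda>s. f (v2 s (x $ 2))) has_derivative (*) (pd 1 f (v2 (x $ 1) (x $ 2)))) (at (x $ 1))"
      using partial_along_line[OF pd(1), of "v2 0 (x $ 2)" "x $ 1"]
      by (simp add: v1[symmetric] has_field_derivative_def)
    show "((\<lambda>t. f (v2 s t)) has_derivative blinfun_apply (blinfun_mult_right (pd 2 f (v2 s t)))) (at t)" for s t
      using partial_along_line[OF pd(2), of "v2 s 0" t]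
      by (simp add: v2[symmetric] has_field_derivative_def)
    have "continuous_on UNIV (\<lambda>q. pd 2 f (v2 (fst q) (snd q)))"
      by (rule continuous_on_compose2[OF c]) (auto simp: v2_def intro!: continuous_intros)
    then have "continuous_on UNIV (\<lambda>q. blinfun_mult_right (pd 2 f (v2 (fst q) (snd q))))"
      by (rule bounded_linear.continuous_on[OF bounded_linear_blinfun_mult_right])
    then show "continuous (at (x $ 1, x $ 2) within UNIV \<times> UNIV) (\<lambda>(s, t). blinfun_mult_right (pd 2 f (v2 s t)))"
      by (simp add: continuous_on_eq_continuous_at case_prod_beta')
  qed auto
  then have 1: "((\<lambda>q. f (v2 (fst q) (snd q))) has_derivative (\<lambda>q. pd 1 f x * fst q + pd 2 f x * snd q)) (at (x $ 1, x $ 2))"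
    by (simp add: v2_eta case_prod_beta')
  have "((\<lambda>x. (x $ 1, x $ 2)) has_derivative (\<lambda>h. (h $ 1, h $ 2))) (at x)"
    by (intro has_derivative_Pair bounded_linear_imp_has_derivative bounded_linear_vec_nth)
  from has_derivative_compose[OF this 1] show ?thesis by (simp add: v2_eta)
qed

definition perp :: "real^2 \<Rightarrow> real^2" where "perp e = v2 (- (e $ 2)) (e $ 1)"

text \<open>The rotation taking 1 to \<open>e\<close>; vertical lines become the lines orthogonal to
  \<open>e\<close>.\<close>

definition frame :: "real^2 \<Rightarrow> complex \<Rightarrow> real^2" where
  "frame e z = Re z *\<^sub>R e + Im z *\<^sub>R perp e"

lemma frame_nth: "frame e z $ 1 = Re z * e $ 1 - Im z * e $ 2" "frame e z $ 2 = Re z * e $ 2 + Im z * e $ 1"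
  by (simp_all add: frame_def perp_def)

lemma norm2: "norm (x :: real^2) = sqrt ((x $ 1)\<^sup>2 + (x $ 2)\<^sup>2)"
  by (simp add: norm_vec_def L2_set_def sum_2)

lemma inner2: "(x :: real^2) \<bullet> y = x $ 1 * y $ 1 + x $ 2 * y $ 2"
  by (simp add: inner_vec_def sum_2)

lemma unit_squares: "norm (e :: real^2) = 1 \<Longrightarrow> (e $ 1)\<^sup>2 + (e $ 2)\<^sup>2 = 1"
  by (simp add: norm2)

lemma norm_frame:
  assumes "norm e = 1"
  shows "norm (frame e z) = cmod z"
proof -
  have "(Re z * e $ 1 - Im z * e $ 2)\<^sup>2 + (Re z * e $ 2 + Im z * e $ 1)\<^sup>2
      = ((Re z)\<^sup>2 + (Im z)\<^sup>2) * ((e $ 1)\<^sup>2 + (e $ 2)\<^sup>2)"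
    by (simp add: power2_eq_square algebra_simps)
  then show ?thesis using unit_squares[OF assms] by (simp add: norm2 frame_nth cmod_def)
qed

lemma has_derivative_frame: "(frame e has_derivative frame e) (at z)"
  unfolding frame_def by (auto intro!: derivative_eq_intros)

lemma continuous_frame: "continuous_on S (frame e)"
  unfolding frame_def by (intro continuous_intros)

lemma frame_inverse:
  assumes "norm e = 1"
  shows "frame e (Complex (x \<bullet> e) (x \<bullet> perp e)) = x"
proof -
  note u = unit_squares[OF assms]
  have "frame e (Complex (x \<bullet> e) (x \<bullet> perp e)) $ 1 = x $ 1 * ((e $ 1)\<^sup>2 + (e $ 2)\<^sup>2)"
    and "frame e (Complex (x \<bullet> e) (x \<bullet> perp e)) $ 2 = x $ 2 * ((e $ 1)\<^sup>2 + (e $ 2)\<^sup>2)"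
    by (simp_all add: frame_nth inner2 perp_def power2_eq_square algebra_simps)
  then show ?thesis using u by (simp add: vec_eq_iff forall_2)
qed

lemma frame_inner:
  assumes "norm e = 1"
  shows "frame e z \<bullet> e = Re z"
proof -
  have "frame e z \<bullet> e = Re z * ((e $ 1)\<^sup>2 + (e $ 2)\<^sup>2)"
    by (simp add: frame_nth inner2 power2_eq_square algebra_simps)
  then show ?thesis using unit_squares[OF assms] by simp
qed

text \<open>Rotation invariance of the Laplacian. \<open>D d\<close> and \<open>H d\<close> are the
  first and second derivatives in direction \<open>d\<close>; in \<open>H e + H (perp e)\<close>
  each mixed term cancels against its own copy.\<close>

lemma C2_frame:
  assumes C2: "C2 F" and e: "norm e = 1"
  obtains F1 F2 F11 F22 where "c2fun (\<lambda>z. F (frame e z)) F1 F2 F11 F22"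
    "\<And>z. F11 z + F22 z = laplacian F (frame e z)"
proof -
  have pdF: "has_pd i F" and cpF: "continuous_on UNIV (pd i F)"
    and pd2F: "has_pd j (pd i F)" and cp2F: "continuous_on UNIV (pd j (pd i F))" for i j
    using C2 by (auto simp: C2_def)
  have dF: "(F has_derivative (\<lambda>h. pd 1 F x * h $ 1 + pd 2 F x * h $ 2)) (at x)" for x
    by (intro has_derivative_of_continuous_partials pdF cpF)
  have dpF: "(pd i F has_derivative (\<lambda>h. pd 1 (pd i F) x * h $ 1 + pd 2 (pd i F) x * h $ 2)) (at x)" for x i
    by (intro has_derivative_of_continuous_partials pd2F cp2F)
  define D where "D = (\<lambda>(d :: real^2) z. pd 1 F (frame e z) * d $ 1 + pd 2 F (frame e z) * d $ 2)"
  define H where "H = (\<lambda>(d :: real^2) z. (pd 1 (pd 1 F) (frame e z) * d $ 1 + pd 2 (pd 1 F) (frame e z) * d $ 2) * d $ 1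
     + (pd 1 (pd 2 F) (frame e z) * d $ 1 + pd 2 (pd 2 F) (frame e z) * d $ 2) * d $ 2)"
  have cD: "continuous_on UNIV (D d)" and cH: "continuous_on UNIV (H d)" for d
    unfolding D_def H_def
    by (intro continuous_intros continuous_on_compose2[OF cpF continuous_frame] continuous_on_compose2[OF cp2F continuous_frame]; simp)+
  have dD: "((\<lambda>t. D (frame e v) (z + of_real t * v)) has_real_derivative H (frame e v) z) (at 0)" for v z
  proof -
    have "((\<lambda>z. pd i F (frame e z)) has_derivative (\<lambda>h. pd 1 (pd i F) (frame e z) * frame e h $ 1 + pd 2 (pd i F) (frame e z) * frame e h $ 2)) (at z)" for i
      using has_derivative_compose[OF has_derivative_frame dpF] by simp
    from line_derivative[OF this]
    have "((\<lambda>t. pd i F (frame e (z + of_real t * v))) has_real_derivative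
       pd 1 (pd i F) (frame e z) * frame e v $ 1 + pd 2 (pd i F) (frame e z) * frame e v $ 2) (at 0)" for i .
    from DERIV_add[OF DERIV_cmult_right[OF this[of 1], of "frame e v $ 1"] DERIV_cmult_right[OF this[of 2], of "frame e v $ 2"]]
    show ?thesis by (simp add: D_def H_def)
  qed
  have f1: "frame e 1 = e" and f2: "frame e \<i> = perp e" by (simp_all add: frame_def)
  have "c2fun (\<lambda>z. F (frame e z)) (D e) (D (perp e)) (H e) (H (perp e))"
    unfolding c2fun_def
  proof (intro conjI allI)
    show "((\<lambda>z. F (frame e z)) has_derivative (\<lambda>h. D e z * Re h + D (perp e) z * Im h)) (at z)" for z
      using has_derivative_compose[OF has_derivative_frame dF]
      by (simp add: D_def frame_nth perp_def algebra_simps)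
    show "((\<lambda>t. D e (z + of_real t)) has_real_derivative H e z) (at 0)" for z
      using dD[of 1 z] by (simp add: f1)
    show "((\<lambda>t. D (perp e) (z + of_real t * \<i>)) has_real_derivative H (perp e) z) (at 0)" for z
      using dD[of \<i> z] by (simp add: f2)
  qed (rule cD cH)+
  moreover have "H e z + H (perp e) z = laplacian F (frame e z)" for z
  proof -
    have "H e z + H (perp e) z = (pd 1 (pd 1 F) (frame e z) + pd 2 (pd 2 F) (frame e z)) * ((e $ 1)\<^sup>2 + (e $ 2)\<^sup>2)"
      by (simp add: H_def perp_def power2_eq_square algebra_simps)
    then show ?thesis using unit_squares[OF e] by (simp add: laplacian_def sum_2)
  qed
  ultimately show ?thesis using that by blast
qed

section \<open>Reflections in arbitrary lines and the centre of symmetry\<close>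

definition reflection :: "real^2 \<Rightarrow> real \<Rightarrow> real^2 \<Rightarrow> real^2" where
  "reflection e m x = x + (2 * (m - x \<bullet> e)) *\<^sub>R e"

lemma frame_mirror:
  assumes "norm e = 1"
  shows "frame e (mirror m z) = reflection e m (frame e z)"
  unfolding reflection_def frame_inner[OF assms] by (simp add: vec_eq_iff frame_def algebra_simps)

text \<open>Two orthogonal reflection symmetries give a central symmetry; since \<open>g\<close> has a unique maximum
  on every line through the centre, all symmetry axes pass through it.\<close>

lemma axes_concurrent:
  fixes g :: "real^2 \<Rightarrow> real"
  assumes sym: "\<And>e x. norm e = 1 \<Longrightarrow> g (reflection e (\<Lambda> e) x) = g x"
    and mono: "\<And>e m x. norm e = 1 \<Longrightarrow> m < \<Lambda> e \<Longrightarrow> x \<bullet> e < m \<Longrightarrow> g x < g (reflection e m x)"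
  obtains x0 where "\<And>e. norm e = 1 \<Longrightarrow> \<Lambda> e = x0 \<bullet> e"
proof -
  define x0 where "x0 = v2 (\<Lambda> (axis 1 1)) (\<Lambda> (axis 2 1))"
  have central: "g (2 *\<^sub>R x0 - x) = g x" for x
  proof -
    have "reflection (axis 1 1) (\<Lambda> (axis 1 1)) (reflection (axis 2 1) (\<Lambda> (axis 2 1)) x) = 2 *\<^sub>R x0 - x"
      by (simp add: reflection_def x0_def vec_eq_iff forall_2 inner2 axis_def)
    then show ?thesis using sym[of "axis 1 1"] sym[of "axis 2 1"] by (metis norm_axis_1)
  qed
  have "\<Lambda> e = x0 \<bullet> e" if e: "norm e = 1" for e
  proof -
    define \<tau> where "\<tau> = \<Lambda> e - x0 \<bullet> e"
    have ee: "e \<bullet> e = 1" using e by (simp add: norm_eq_1)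
    define h where "h = (\<lambda>t. g (x0 + t *\<^sub>R e))"
    have incr: "h a < h b" if "a < b" "b \<le> \<tau>" for a b
    proof -
      have "reflection e ((a + b) / 2 + x0 \<bullet> e) (x0 + a *\<^sub>R e) = x0 + b *\<^sub>R e"
        by (simp add: reflection_def inner_add_left ee scaleR_left_distrib[symmetric] field_simps)
      moreover have "g (x0 + a *\<^sub>R e) < g (reflection e ((a + b) / 2 + x0 \<bullet> e) (x0 + a *\<^sub>R e))"
      proof (rule mono[OF e])
        show "(a + b) / 2 + x0 \<bullet> e < \<Lambda> e" using that unfolding \<tau>_def by argo
        show "(x0 + a *\<^sub>R e) \<bullet> e < (a + b) / 2 + x0 \<bullet> e" using that ee by (simp add: inner_add_left)
      qed
      ultimately show ?thesis by (simp add: h_def)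
    qed
    have even: "h (- t) = h t" for t
      using central[of "x0 + t *\<^sub>R e"] by (simp add: h_def algebra_simps scaleR_2)
    have sy: "h (2 * \<tau> - t) = h t" for t
    proof -
      have "reflection e (\<Lambda> e) (x0 + t *\<^sub>R e) = x0 + (2 * \<tau> - t) *\<^sub>R e"
        by (simp add: reflection_def inner_add_left ee \<tau>_def vec_eq_iff algebra_simps)
      then show ?thesis using sym[OF e, of "x0 + t *\<^sub>R e"] by (simp add: h_def)
    qed
    have "\<tau> = 0"
    proof (rule ccontr)
      \<comment> \<open>\<open>h\<close> is even and strictly increasing up to
        \<open>\<tau>\<close>. If \<open>\<tau> > 0\<close>, then
        \<open>h (- \<tau>) = h \<tau>\<close> is impossible; if \<open>\<tau> < 0\<close>, symmetry
        about \<open>\<tau>\<close> gives \<open>h (3 * \<tau>) = h (- \<tau>) = h \<tau>\<close>,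
        equally impossible.\<close>
      assume "\<tau> \<noteq> 0"
      then consider "\<tau> > 0" | "\<tau> < 0" by linarith
      then show False
      proof cases
        case 1 then show ?thesis using incr[of "- \<tau>" \<tau>] even[of \<tau>] by simp
      next
        case 2 then show ?thesis using incr[of "3 * \<tau>" \<tau>] even[of \<tau>] sy[of "- \<tau>"] by simp
      qed
    qed
    then show ?thesis by (simp add: \<tau>_def)
  qed
  then show ?thesis using that by blast
qed

text \<open>Two points equidistant from \<open>x0\<close> are mirror images in their perpendicular
  bisector, which passes through \<open>x0\<close>. For unequal distances \<open>a < b\<close>, the
  point nearer to \<open>x0\<close> is first moved onto the ray from \<open>x0\<close> through
  \<open>y\<close>; the bisector of the two points on that ray is at distance
  \<open>(a + b) / 2 > 0\<close> from \<open>x0\<close>, so \<open>mono\<close> applies.\<close>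

lemma radial_of_reflections:
  fixes g :: "real^2 \<Rightarrow> real"
  assumes sym: "\<And>e x. norm e = 1 \<Longrightarrow> g (reflection e (x0 \<bullet> e) x) = g x"
    and mono: "\<And>e m x. norm e = 1 \<Longrightarrow> m < x0 \<bullet> e \<Longrightarrow> x \<bullet> e < m \<Longrightarrow> g x < g (reflection e m x)"
  shows "norm (x - x0) = norm (y - x0) \<Longrightarrow> g x = g y"
    and "norm (x - x0) < norm (y - x0) \<Longrightarrow> g y < g x"
proof -
  have eq: "g x = g y" if n: "norm (x - x0) = norm (y - x0)" for x y
  proof (cases "x = y")
    case False
    define e where "e = (x - y) /\<^sub>R norm (x - y)"
    have e: "norm e = 1" using False by (simp add: e_def)
    have "(x - x0) \<bullet> (x - x0) = (y - x0) \<bullet> (y - x0)" using n by (simp add: norm_eq_sqrt_inner)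
    then have *: "2 * ((x0 - x) \<bullet> (x - y)) = - ((x - y) \<bullet> (x - y))"
      by (simp add: inner_diff_left inner_diff_right inner_commute algebra_simps)
    have "x0 \<bullet> e - x \<bullet> e = ((x0 - x) \<bullet> (x - y)) / norm (x - y)"
      unfolding inner_diff_left[symmetric] by (simp add: e_def divide_inverse mult.commute)
    then have "(2 * (x0 \<bullet> e - x \<bullet> e)) *\<^sub>R e = (2 * (((x0 - x) \<bullet> (x - y)) / norm (x - y))) *\<^sub>R ((x - y) /\<^sub>R norm (x - y))"
      by (simp only: e_def)
    also have "\<dots> = ((2 * ((x0 - x) \<bullet> (x - y))) / (norm (x - y))\<^sup>2) *\<^sub>R (x - y)"
      by (simp add: power2_eq_square divide_inverse mult_ac)
    also have "\<dots> = y - x" unfolding * using False by (simp add: dot_square_norm)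
    finally have "reflection e (x0 \<bullet> e) x = y" by (simp add: reflection_def)
    then show ?thesis using sym[OF e, of x] by simp
  qed simp
  then show "norm (x - x0) = norm (y - x0) \<Longrightarrow> g x = g y" .
  assume lt: "norm (x - x0) < norm (y - x0)"
  define a where "a = norm (x - x0)"
  define b where "b = norm (y - x0)"
  have ab: "0 \<le> a" "a < b" using lt by (auto simp: a_def b_def)
  define e where "e = (x0 - y) /\<^sub>R b"
  have e: "norm e = 1" using ab norm_minus_commute[of x0 y] by (simp add: e_def b_def[symmetric])
  have ee: "e \<bullet> e = 1" using e by (simp add: norm_eq_1)
  have y: "y = x0 + (- b) *\<^sub>R e" using ab by (simp add: e_def)
  have ye: "y \<bullet> e = x0 \<bullet> e - b" by (simp add: y inner_diff_left ee)
  have "2 * (x0 \<bullet> e - (a + b) / 2 - y \<bullet> e) = b - a" unfolding ye by (simp add: field_simps)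
  then have "reflection e (x0 \<bullet> e - (a + b) / 2) y = x0 + (- a) *\<^sub>R e"
    unfolding reflection_def by (subst y) (simp add: scaleR_left_diff_distrib)
  moreover have "g y < g (reflection e (x0 \<bullet> e - (a + b) / 2) y)"
    by (rule mono[OF e]; use ab ye in argo)
  moreover have "g (x0 + (- a) *\<^sub>R e) = g x" by (rule eq) (use e ab in \<open>simp add: a_def\<close>)
  ultimately show "g y < g x" by simp
qed

theorem theorem1p3:
  fixes p \<gamma> :: real and f :: "real \<Rightarrow> real" and u w :: "real^2 \<Rightarrow> real"
  assumes "p \<ge> 2" and "\<gamma> > 0"
    and "locally_lipschitz f" and "f 0 = 0"
    and "p > 2 \<Longrightarrow> (\<exists>\<epsilon>0>0. \<exists>a0>0. \<forall>x y. 0 < x \<and> x < \<epsilon>0 \<and> 0 < y \<and> y < \<epsilon>0 \<and> x \<noteq> y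
            \<longrightarrow> (f x - f y) / (x - y) \<le> - a0)"
    and "C2 u" and "C2 w"
    and "\<And>x. - laplacian u x - \<gamma> * w x * \<bar>u x\<bar> powr (p - 2) * u x = f (u x)"
    and "\<And>x. - laplacian w x = \<bar>u x\<bar> powr p"
    and "\<And>x. u x > 0" and "bounded (range u)"
    and "filterlim w at_bot at_infinity"
  shows "\<exists>x0 :: real^2.
           (\<forall>x y. norm (x - x0) = norm (y - x0) \<longrightarrow> u x = u y \<and> w x = w y) \<and>
           (\<forall>x y. norm (x - x0) < norm (y - x0) \<longrightarrow> u y < u x \<and> w y < w x)"
proof -
  have dir: "\<exists>l. (\<forall>x. u (reflection e l x) = u x \<and> w (reflection e l x) = w x) \<and>
     (\<forall>m<l. \<forall>x. x \<bullet> e < m \<longrightarrow> u x < u (reflection e m x) \<and> w x < w (reflection e m x))"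
    if e: "norm e = 1" for e
  proof -
    obtain u1 u2 u11 u22 where cu: "c2fun (\<lambda>z. u (frame e z)) u1 u2 u11 u22"
      and lu: "\<And>z. u11 z + u22 z = laplacian u (frame e z)"
      using C2_frame[OF assms(6) e] by blast
    obtain w1 w2 w11 w22 where cw: "c2fun (\<lambda>z. w (frame e z)) w1 w2 w11 w22"
      and lw: "\<And>z. w11 z + w22 z = laplacian w (frame e z)"
      using C2_frame[OF assms(7) e] by blast
    interpret choquard p \<gamma> f "\<lambda>z. u (frame e z)" u1 u2 u11 u22 "\<lambda>z. w (frame e z)" w1 w2 w11 w22
    proof
      fix z
      let ?x = "frame e z"
      have "\<bar>u ?x\<bar> powr (p - 2) * u ?x = u ?x powr (p - 1)"
        using assms(10)[of ?x] powr_mult_base[of "u ?x" "p - 2"] by (simp add: mult.commute)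
      then have "\<gamma> * w ?x * \<bar>u ?x\<bar> powr (p - 2) * u ?x = \<gamma> * w ?x * u ?x powr (p - 1)" by (simp add: mult.assoc)
      then show "u11 z + u22 z = - (\<gamma> * w ?x * u ?x powr (p - 1) + f (u ?x))"
        using assms(8)[of ?x] lu[of z] by linarith
      show "w11 z + w22 z = - (u ?x powr p)"
        using assms(9)[of ?x] assms(10)[of ?x] lw[of z] by simp
      show "bounded (range (\<lambda>z. u (frame e z)))"
        using assms(11) by (rule bounded_subset) auto
      have "filterlim (frame e) at_infinity at_infinity"
        by (rule filterlim_norm_at_top_imp_at_infinity) (simp add: norm_frame[OF e] filterlim_norm_at_top)
      then show "filterlim (\<lambda>z. w (frame e z)) at_bot at_infinity"
        by (rule filterlim_compose[OF assms(12)])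
    qed (fact assms cu cw)+
    obtain l where l: "\<And>z. u (frame e (mirror l z)) = u (frame e z)" "\<And>z. w (frame e (mirror l z)) = w (frame e z)"
      "\<And>m z. m < l \<Longrightarrow> Re z < m \<Longrightarrow> u (frame e z) < u (frame e (mirror m z)) \<and> w (frame e z) < w (frame e (mirror m z))"
      using moving_plane by blast
    have "u (reflection e l x) = u x" "w (reflection e l x) = w x" for x
      using l(1,2)[of "Complex (x \<bullet> e) (x \<bullet> perp e)"] by (simp_all add: frame_mirror[OF e] frame_inverse[OF e])
    moreover have "u x < u (reflection e m x) \<and> w x < w (reflection e m x)" if "m < l" "x \<bullet> e < m" for m x
      using l(3)[of m "Complex (x \<bullet> e) (x \<bullet> perp e)"] that by (simp add: frame_mirror[OF e] frame_inverse[OF e])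
    ultimately show ?thesis by blast
  qed
  define P where "P e l \<longleftrightarrow> (\<forall>x. u (reflection e l x) = u x \<and> w (reflection e l x) = w x) \<and>
     (\<forall>m<l. \<forall>x. x \<bullet> e < m \<longrightarrow> u x < u (reflection e m x) \<and> w x < w (reflection e m x))" for e l
  have "\<forall>e\<in>{e. norm e = 1}. \<exists>l. P e l" using dir by (simp add: P_def)
  from bchoice[OF this] obtain \<Lambda> where P: "\<And>e. norm e = 1 \<Longrightarrow> P e (\<Lambda> e)" by auto
  note sym = P[unfolded P_def, THEN conjunct1, rule_format]
  note mono = P[unfolded P_def, THEN conjunct2, rule_format]
  \<comment> \<open>The centre is found from \<open>u\<close> alone; each \<open>\<Lambda> e\<close>
    is an axis for \<open>u\<close> and \<open>w\<close> at once, so the same centre serves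
    \<open>w\<close>.\<close>
  obtain x0 where x0: "\<And>e. norm e = 1 \<Longrightarrow> \<Lambda> e = x0 \<bullet> e"
    by (rule axes_concurrent[of u \<Lambda>]) (use sym mono in auto)
  have ru: "norm (x - x0) = norm (y - x0) \<Longrightarrow> u x = u y" "norm (x - x0) < norm (y - x0) \<Longrightarrow> u y < u x"
    and rw: "norm (x - x0) = norm (y - x0) \<Longrightarrow> w x = w y" "norm (x - x0) < norm (y - x0) \<Longrightarrow> w y < w x" for x y
    using radial_of_reflections[of u x0 x y] radial_of_reflections[of w x0 x y] sym mono by (simp_all add: x0[symmetric])
  show ?thesis by (intro exI[of _ x0] conjI allI impI ru rw)
qed

end
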